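(* Let $\mathbb E=\mathbb R$ or $\mathbb E=\mathbb C$, let $k\ge n\ge1$ be integers and let $a=(a_1,\dots,a_n)$ be real numbers with $a_1\ge a_2\ge\cdots\ge a_n>0$. The map $\pi:\mathcal F^{\mathbb E}_k(a)\to\mathcal G^{\mathbb E}_k(a)$, $\pi(F)=F^*D_n(a)F$, is a locally trivial fiber bundle with fiber $\mathcal T^{\mathbb E}_n(a)$.
   Context: $\mathcal O^{\mathbb E}_m$ is the group of $m\times m$ orthogonal matrices if $\mathbb E=\mathbb R$ and of $m\times m$ unitary matrices if $\mathbb E=\mathbb C$; $*$ is the (conjugate) transpose. A list $F=(f_1,\dots,f_k)$ of vectors in $\mathbb E^n$ is a tight frame if there is $B>0$ with $\sum_{i=1}^k|\langle v,f_i\rangle|^2=B\|v\|^2$ for all $v\in\mathbb E^n$. $F$ is identified with the $n\times k$ matrix whose columns are $f_1,\dots,f_k$ in this order. Put $D_n(a)=\mathrm{diag}(a_1,\dots,a_n)\in M_n(\mathbb R)$ and $D_k(a)=\mathrm{diag}(a_1,\dots,a_n,0,\dots,0)\in M_k(\mathbb R)$. The ellipsoid is $\mathcal E^{\mathbb E}(a)=\{v\in\mathbb E^n\mid\sum_{j=1}^na_j|v_j|^2=1\}$. $\mathcal F^{\mathbb E}_k(a)$ is the set of all ordered tight frames of $k$ vectors for $\mathbb E^n$ all of whose vectors lie on $\mathcal E^{\mathbb E}(a)$, with the relative topology from $n\times k$ matrices. $\mathcal T^{\mathbb E}_n(a)=\{V\in\mathcal O^{\mathbb E}_n\mid V(\mathcal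 E^{\mathbb E}(a))=\mathcal E^{\mathbb E}(a)\}$. $\mathcal G^{\mathbb E}_k(a)=\{R=\frac{k}{a_1+\cdots+a_n}U^*D_k(a)U\mid U\in\mathcal O^{\mathbb E}_k,\ R_{ii}=1\ (1\le i\le k)\}$, with the relative topology from $M_k(\mathbb E)$; $\pi$ does take values in this set. *)

theory Defs
  imports "HOL-Analysis.Product_Topology" "HOL-Analysis.L2_Norm"
    "Jordan_Normal_Form.Schur_Decomposition"
begin

text \<open>
  Matrices and vectors are those of Jordan-Normal-Form, with entries in a type \<open>'e\<close>; only
  \<open>'e = real\<close> and \<open>'e = complex\<close> are intended. There, \<open>conjugate\<close> is the identity and
  complex conjugation respectively, so \<^const>\<open>mat_adjoint\<close> is the transpose and the conjugate
  transpose. Indices are zero-based: \<open>a $ i\<close> is the mathematical $a_{i+1}$. The parameter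
  \<open>a\<close> is a real vector, and $n$ is its dimension.
\<close>

definition mat_topology :: "nat \<Rightarrow> nat \<Rightarrow> 'e::topological_space mat topology" where
  "mat_topology r c =
     pullback_topology (carrier_mat r c)
       (\<lambda>A. restrict (\<lambda>(i, j). A $$ (i, j)) ({..<r} \<times> {..<c}))
       (product_topology (\<lambda>_. euclidean) ({..<r} \<times> {..<c}))"

lemma topspace_mat_topology [simp]: "topspace (mat_topology r c) = carrier_mat r c"
  by (auto simp: mat_topology_def topspace_pullback_topology)

definition unitary_group :: "nat \<Rightarrow> 'e::conjugatable_field mat set" where
  "unitary_group m =
     {U \<in> carrier_mat m m. mat_adjoint U * U = 1\<^sub>m m \<and> U * mat_adjoint U = 1\<^sub>m m}"

definition vec_norm :: "'e::real_normed_field vec \<Rightarrow> real" where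
  "vec_norm v = L2_set (\<lambda>j. norm (v $ j)) {..<dim_vec v}"

definition tight_frame ::
    "nat \<Rightarrow> 'e::{conjugatable_field, real_normed_field} vec list \<Rightarrow> bool" where
  "tight_frame n fs \<longleftrightarrow> set fs \<subseteq> carrier_vec n \<and>
     (\<exists>B>0. \<forall>v\<in>carrier_vec n. (\<Sum>f\<leftarrow>fs. (norm (v \<bullet>c f))\<^sup>2) = B * (vec_norm v)\<^sup>2)"

text \<open>\<open>diag_pad m a\<close> is $D_m(a)$ for every \<open>m \<ge> dim_vec a\<close>; it covers both $D_n(a)$ and
  the zero-padded $D_k(a)$.\<close>

definition diag_pad :: "nat \<Rightarrow> real vec \<Rightarrow> 'e::real_normed_field mat" where
  "diag_pad m a =
     mat m m (\<lambda>(i, j). if i = j \<and> i < dim_vec a then of_real (a $ i) else 0)"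

definition ellipsoid :: "real vec \<Rightarrow> 'e::real_normed_field vec set" where
  "ellipsoid a =
     {v \<in> carrier_vec (dim_vec a). (\<Sum>j<dim_vec a. a $ j * (norm (v $ j))\<^sup>2) = 1}"

definition ellipsoid_frames ::
    "nat \<Rightarrow> real vec \<Rightarrow> 'e::{conjugatable_field, real_normed_field} mat set" where
  "ellipsoid_frames k a =
     {F \<in> carrier_mat (dim_vec a) k.
        tight_frame (dim_vec a) (cols F) \<and> set (cols F) \<subseteq> ellipsoid a}"

definition ellipsoid_group ::
    "real vec \<Rightarrow> 'e::{conjugatable_field, real_normed_field} mat set" where
  "ellipsoid_group a =
     {V \<in> unitary_group (dim_vec a). (\<lambda>v. V *\<^sub>v v) ` ellipsoid a = ellipsoid a}"

definition gram_matrices ::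
    "nat \<Rightarrow> real vec \<Rightarrow> 'e::{conjugatable_field, real_normed_field} mat set" where
  "gram_matrices k a =
     {R. (\<exists>U\<in>unitary_group k.
            R = of_real (real k / (\<Sum>j<dim_vec a. a $ j))
                  \<cdot>\<^sub>m (mat_adjoint U * diag_pad k a * U)) \<and>
         (\<forall>i<k. R $$ (i, i) = 1)}"

definition frame_space ::
    "nat \<Rightarrow> real vec \<Rightarrow> 'e::{conjugatable_field, real_normed_field} mat topology" where
  "frame_space k a = subtopology (mat_topology (dim_vec a) k) (ellipsoid_frames k a)"

definition gram_space ::
    "nat \<Rightarrow> real vec \<Rightarrow> 'e::{conjugatable_field, real_normed_field} mat topology" where
  "gram_space k a = subtopology (mat_topology k k) (gram_matrices k a)"

definition ellipsoid_group_space ::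
    "real vec \<Rightarrow> 'e::{conjugatable_field, real_normed_field} mat topology" where
  "ellipsoid_group_space a =
     subtopology (mat_topology (dim_vec a) (dim_vec a)) (ellipsoid_group a)"

definition gram_map ::
    "real vec \<Rightarrow> 'e::{conjugatable_field, real_normed_field} mat \<Rightarrow> 'e mat" where
  "gram_map a F = mat_adjoint F * diag_pad (dim_vec a) a * F"

text \<open>Surjectivity of \<open>p\<close>, which some authors require of a bundle projection, is not listed
  separately: for a nonempty fiber it follows from local triviality, as shown below.\<close>

definition locally_trivial_bundle ::
    "'x topology \<Rightarrow> 'b topology \<Rightarrow> ('x \<Rightarrow> 'b) \<Rightarrow> 'f topology \<Rightarrow> bool" where
  "locally_trivial_bundle X B p Fib \<longleftrightarrow>
     continuous_map X B p \<and>
     (\<forall>b\<in>topspace B. \<exists>W. openin B W \<and> b \<in> W \<and>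
        (\<exists>\<phi>. homeomorphic_map (subtopology X {x \<in> topspace X. p x \<in> W})
                 (prod_topology (subtopology B W) Fib) \<phi> \<and>
              (\<forall>x\<in>topspace X. p x \<in> W \<longrightarrow> fst (\<phi> x) = p x)))"

lemma locally_trivial_bundle_surj:
  assumes "locally_trivial_bundle X B p Fib" and "topspace Fib \<noteq> {}"
  shows "p ` topspace X = topspace B"
proof
  show "p ` topspace X \<subseteq> topspace B"
    using assms(1) by (auto simp: locally_trivial_bundle_def continuous_map_def)
  show "topspace B \<subseteq> p ` topspace X"
  proof
    fix b assume b: "b \<in> topspace B"
    obtain y where y: "y \<in> topspace Fib" using assms(2) by blast
    obtain W \<phi> where W: "b \<in> W"
      and hom: "homeomorphic_map (subtopology X {x \<in> topspace X. p x \<in> W})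
                 (prod_topology (subtopology B W) Fib) \<phi>"
      and fst: "\<forall>x\<in>topspace X. p x \<in> W \<longrightarrow> fst (\<phi> x) = p x"
      using assms(1) b unfolding locally_trivial_bundle_def by blast
    have "(b, y) \<in> \<phi> ` topspace (subtopology X {x \<in> topspace X. p x \<in> W})"
      using homeomorphic_imp_surjective_map[OF hom] b y W by simp
    then obtain x where "x \<in> topspace X" "p x \<in> W" "\<phi> x = (b, y)" by auto
    then show "b \<in> p ` topspace X" using fst by force
  qed
qed

end

theory Submission
  imports Defs
begin

text \<open>Put $\beta=k/(a_1+\cdots+a_n)$, $D=D_n(a)$ and $\pi(F)=F^*DF$. A matrix \<open>F\<close> is a tight frame on
  the ellipsoid exactly when $FF^*=\beta I$ and the diagonal of $F^*DF$ consists of ones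
  (\<open>ellipsoid_frames_iff\<close>), and $\mathcal T_n(a)$ consists of the unitary \<open>V\<close> with $V^*DV=D$
  (\<open>ellipsoid_group_iff\<close>). Hence $\mathcal T_n(a)$ acts on the frames by left multiplication and preserves
  \<open>\<pi>\<close> (\<open>group_acts_on_fibers\<close>). The action is simply transitive on each fiber of \<open>\<pi>\<close>: if
  $\pi(F)=\pi(G)$, then the unique \<open>V\<close> with \<open>F = V G\<close> is $\beta^{-1}FG^*$
  (\<open>transition_of_equal_gram\<close>), which depends continuously on \<open>F\<close> and \<open>G\<close>. So a continuous local
  section \<open>s\<close> of \<open>\<pi>\<close> gives the local trivialisation
  $F\mapsto(\pi(F),\beta^{-1}F\,s(\pi(F))^*)$ with inverse $(R,V)\mapsto V s(R)$.

  To construct \<open>s\<close>, note that all matrices in $\mathcal G_k(a)$ are Hermitian with the same spectrum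
  $\beta a_1,\dots,\beta a_n,0,\dots,0$. Near any $R_0$ such matrices can be diagonalised by a unitary
  matrix depending continuously on \<open>R\<close> (\<open>local_continuous_diagonalisation\<close>): fix an orthonormal eigenbasis
  $f_1,\dots,f_k$ of $R_0$ and run the Gram-Schmidt process, applying at step \<open>m\<close> to the residual of
  $f_m$ the product of $R-\mu$ over the eigenvalues $\mu$ other than that of $f_m$. This
  polynomial in \<open>R\<close> is continuous, maps into the right eigenspace, keeps vectors orthogonal to the
  eigenvectors already found, and does not kill the residual at $R_0$, hence not near $R_0$.
  If $R=U^*\,\beta D_k(a)\,U$, then $\sqrt\beta$ times the first \<open>n\<close> rows of \<open>U\<close> form the frame $s(R)$
  (\<open>gram_top_frame\<close>).\<close>

section \<open>Scalars with a conjugation\<close>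

text \<open>The common setting of the real and the complex case: a normed field whose conjugation
  satisfies $x\bar x=|x|^2$. This makes the conjugation isometric, hence continuous, and makes it fix
  every real scalar.\<close>

class conj_normed_field = conjugatable_field + real_normed_field +
  assumes mult_conjugate_scaleR: "x * conjugate x = (norm x * norm x) *\<^sub>R 1"

instance real :: conj_normed_field
  by standard (simp add: power2_eq_square)

instance complex :: conj_normed_field
  by standard (simp add: complex_norm_square[symmetric] scaleR_conv_of_real power2_eq_square
      del: of_real_mult)

lemma mult_conjugate: "x * conjugate x = of_real ((norm (x::'e::conj_normed_field))\<^sup>2)"
  by (simp add: mult_conjugate_scaleR of_real_def power2_eq_square)

lemma conjugate_one [simp]: "conjugate (1::'e::conj_normed_field) = 1"
  using mult_conjugate[of "1::'e"] by simp

lemma conjugate_of_real [simp]: "conjugate (of_real r :: 'e::conj_normed_field) = of_real r"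
proof (cases "r = 0")
  case False
  have "of_real r * conjugate (of_real r :: 'e) = of_real r * of_real r"
    using mult_conjugate[of "of_real r :: 'e"] by (simp add: power2_eq_square)
  then show ?thesis using False by simp
qed simp

lemma conjugate_diff:
  "conjugate (x - y) = conjugate x - conjugate (y::'e::conj_normed_field)"
  using conjugate_dist_add[of x "- y"] by (simp add: conjugate_neg)

lemma norm_conjugate [simp]: "norm (conjugate x) = norm (x::'e::conj_normed_field)"
proof (cases "x = 0")
  case False
  have "norm x * norm (conjugate x) = norm x * norm x"
    using arg_cong[OF mult_conjugate[of x], of norm]
    by (simp add: norm_mult power2_eq_square)
  then show ?thesis using False by simp
qed simp

lemma tendsto_conjugate [tendsto_intros]:
  fixes f :: "'x \<Rightarrow> 'e::conj_normed_field"
  assumes "(f \<longlongrightarrow> l) F"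
  shows "((\<lambda>x. conjugate (f x)) \<longlongrightarrow> conjugate l) F"
proof -
  have "bounded_linear (conjugate :: 'e \<Rightarrow> 'e)"
    by (rule bounded_linear_intro[where K=1])
      (simp_all add: conjugate_dist_add scaleR_conv_of_real conjugate_dist_mul)
  then show ?thesis using assms by (rule bounded_linear.tendsto)
qed


section \<open>Coordinate vectors and orthonormal families\<close>

text \<open>Vectors of length \<open>k\<close> are functions on \<open>nat\<close> of which only the values below \<open>k\<close> matter.
  This spares the dimension bookkeeping in linear combinations of vectors.\<close>

text \<open>The inner product of $\mathbb E^k$, linear in the first argument.\<close>

definition ip :: "nat \<Rightarrow> (nat \<Rightarrow> 'e) \<Rightarrow> (nat \<Rightarrow> 'e) \<Rightarrow> 'e::conj_normed_field" where
  "ip k x y = (\<Sum>l<k. x l * conjugate (y l))"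

text \<open>The product of a matrix with \<open>k\<close> columns and a vector.\<close>

definition app :: "nat \<Rightarrow> 'e mat \<Rightarrow> (nat \<Rightarrow> 'e) \<Rightarrow> nat \<Rightarrow> 'e::conj_normed_field" where
  "app k M x i = (\<Sum>l<k. M $$ (i, l) * x l)"

lemma ip_conjugate: "conjugate (ip k x y) = ip k y x"
  by (simp add: ip_def sum_conjugate conjugate_dist_mul mult.commute)

lemma ip_cong:
  "(\<And>l. l < k \<Longrightarrow> x l = x' l) \<Longrightarrow> (\<And>l. l < k \<Longrightarrow> y l = y' l) \<Longrightarrow> ip k x y = ip k x' y'"
  by (simp add: ip_def)

lemma ip_add_left: "ip k (\<lambda>l. x l + y l) z = ip k x z + ip k y z"
  by (simp add: ip_def algebra_simps sum.distrib)

lemma ip_add_right: "ip k z (\<lambda>l. x l + y l) = ip k z x + ip k z y"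
  by (simp add: ip_def algebra_simps sum.distrib conjugate_dist_add)

lemma ip_diff_left: "ip k (\<lambda>l. x l - y l) z = ip k x z - ip k y z"
  by (simp add: ip_def algebra_simps sum_subtractf)

lemma ip_scale_left: "ip k (\<lambda>l. c * x l) z = c * ip k x z"
  by (simp add: ip_def sum_distrib_left mult.assoc)

lemma ip_scale_right: "ip k z (\<lambda>l. c * x l) = conjugate c * ip k z x"
  by (simp add: ip_def sum_distrib_left conjugate_dist_mul mult_ac)

lemma ip_sum_left: "ip k (\<lambda>l. \<Sum>j\<in>J. x j l) z = (\<Sum>j\<in>J. ip k (x j) z)"
  unfolding ip_def sum_distrib_right by (rule sum.swap)

lemma ip_self: "ip k x x = of_real (\<Sum>l<k. (norm (x l))\<^sup>2)"
  by (simp add: ip_def mult_conjugate)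

lemma ip_self_eq_0: "ip k x x = 0 \<longleftrightarrow> (\<forall>l<k. x l = 0)"
  by (auto simp: ip_self of_real_eq_0_iff sum_nonneg_eq_0_iff simp del: of_real_sum of_real_power)

lemma ip_unit_right: "i < k \<Longrightarrow> ip k x (\<lambda>l. if l = i then 1 else 0) = x i"
  by (simp add: ip_def if_distrib[of conjugate] if_distrib[of "\<lambda>c. _ * c"] cong: if_cong)

lemma app_add: "app k M (\<lambda>l. x l + y l) i = app k M x i + app k M y i"
  by (simp add: app_def algebra_simps sum.distrib)

lemma app_scale: "app k M (\<lambda>l. c * x l) i = c * app k M x i"
  by (simp add: app_def sum_distrib_left mult_ac)

lemma app_cong: "(\<And>l. l < k \<Longrightarrow> x l = y l) \<Longrightarrow> app k M x i = app k M y i"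
  by (simp add: app_def)

lemma app_unit: "i < k \<Longrightarrow> app k M (\<lambda>l. if l = i then 1 else 0) j = M $$ (j, i)"
  by (simp add: app_def if_distrib[of "\<lambda>c. _ * c"] cong: if_cong)

text \<open>The vectors \<open>r 0, \<dots>, r (m - 1)\<close> of length \<open>k\<close> form an orthonormal family.\<close>

definition orthonormal :: "nat \<Rightarrow> nat \<Rightarrow> (nat \<Rightarrow> nat \<Rightarrow> 'e::conj_normed_field) \<Rightarrow> bool" where
  "orthonormal k m r \<longleftrightarrow> (\<forall>i<m. \<forall>j<m. ip k (r i) (r j) = (if i = j then 1 else 0))"

text \<open>What remains of \<open>x\<close> after its components along \<open>r 0, \<dots>, r (m - 1)\<close> are removed.\<close>

definition residual ::
    "nat \<Rightarrow> nat \<Rightarrow> (nat \<Rightarrow> nat \<Rightarrow> 'e) \<Rightarrow> (nat \<Rightarrow> 'e) \<Rightarrow> nat \<Rightarrow> 'e::conj_normed_field" where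
  "residual k m r x l = x l - (\<Sum>j<m. ip k x (r j) * r j l)"

lemma ip_residual: "ip k (residual k m r x) y = ip k x y - (\<Sum>j<m. ip k x (r j) * ip k (r j) y)"
  unfolding residual_def ip_diff_left ip_sum_left ip_scale_left by simp

lemma residual_orthogonal:
  assumes "orthonormal k m r" "i < m"
  shows "ip k (residual k m r x) (r i) = 0"
proof -
  have "(\<Sum>j<m. ip k x (r j) * ip k (r j) (r i)) = (\<Sum>j<m. if j = i then ip k x (r j) else 0)"
    using assms by (intro sum.cong) (auto simp: orthonormal_def)
  then show ?thesis using assms(2) by (simp add: ip_residual)
qed

text \<open>\<open>x\<close> divided by its norm; since \<open>inverse 0 = 0\<close>, a vector that vanishes below \<open>k\<close> becomes zero.\<close>

definition normalized :: "nat \<Rightarrow> (nat \<Rightarrow> 'e) \<Rightarrow> nat \<Rightarrow> 'e::conj_normed_field" where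
  "normalized k x l = of_real (inverse (sqrt (\<Sum>l<k. (norm (x l))\<^sup>2))) * x l"

lemma ip_normalized_left: 
  "ip k (normalized k x) y = of_real (inverse (sqrt (\<Sum>l<k. (norm (x l))\<^sup>2))) * ip k x y"
  unfolding normalized_def by (rule ip_scale_left)

lemma app_normalized:
  "app k M (normalized m x) i = of_real (inverse (sqrt (\<Sum>l<m. (norm (x l))\<^sup>2))) * app k M x i"
  unfolding normalized_def by (rule app_scale)

lemma ip_normalized:
  assumes "ip k x x \<noteq> 0"
  shows "ip k (normalized k x) (normalized k x) = 1"
proof -
  define s where "s = (\<Sum>l<k. (norm (x l))\<^sup>2)"
  have s: "ip k x x = of_real s" by (simp add: ip_self s_def)
  have "0 \<le> s" by (simp add: s_def sum_nonneg)
  with assms s have pos: "0 < s" by (cases "s = 0") auto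
  have "ip k (normalized k x) (normalized k x) =
      of_real (inverse (sqrt s)) * (of_real (inverse (sqrt s)) * of_real s)"
    unfolding normalized_def ip_scale_left ip_scale_right s s_def[symmetric] conjugate_of_real ..
  also have "\<dots> = of_real (inverse (sqrt s) * (inverse (sqrt s) * s))"
    by (simp only: of_real_mult)
  also have "inverse (sqrt s) * (inverse (sqrt s) * s) = 1"
    using pos by (simp add: field_simps)
  finally show ?thesis by simp
qed

lemma orthonormal_Suc:
  assumes r: "orthonormal k m r" and x: "\<And>i. i < m \<Longrightarrow> ip k x (r i) = 0" "ip k x x = 1"
    and r': "\<And>i. i < m \<Longrightarrow> r' i = r i" "r' m = x"
  shows "orthonormal k (Suc m) r'"
proof -
  have "ip k (r i) x = 0" if "i < m" for i
    using x(1)[OF that] ip_conjugate[of k x "r i"] by simp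
  then show ?thesis
    using r x r' by (auto simp: orthonormal_def less_Suc_eq)
qed

text \<open>Fewer than \<open>k\<close> orthonormal vectors do not span: otherwise
  $1=\sum_{j<m}|r_j(l)|^2$ for each coordinate \<open>l\<close>, and summing over \<open>l\<close> gives $k=m$.\<close>

lemma exists_orthogonal_vector:
  fixes r :: "nat \<Rightarrow> nat \<Rightarrow> 'e::conj_normed_field"
  assumes r: "orthonormal k m r" and "m < k"
  shows "\<exists>x. ip k x x \<noteq> 0 \<and> (\<forall>i<m. ip k x (r i) = 0)"
proof (rule ccontr)
  assume "\<not> ?thesis"
  then have zero: "ip k x x = 0" if "\<And>i. i < m \<Longrightarrow> ip k x (r i) = 0" for x
    using that by blast
  have one: "(\<Sum>j<m. r j l * conjugate (r j l)) = 1" if l: "l < k" for l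
  proof -
    define e where "e = (\<lambda>i. if i = l then 1 else 0 :: 'e)"
    have "ip k (residual k m r e) (residual k m r e) = 0"
      by (rule zero) (rule residual_orthogonal[OF r])
    then have "residual k m r e l = 0" using l by (simp add: ip_self_eq_0)
    moreover have "ip k e (r j) = conjugate (r j l)" for j
      using ip_conjugate[of k "r j" e] ip_unit_right[OF l, of "r j"] by (simp add: e_def)
    ultimately show ?thesis by (simp add: residual_def e_def mult.commute)
  qed
  have "of_nat k = (\<Sum>l<k. \<Sum>j<m. r j l * conjugate (r j l))" by (simp add: one)
  also have "\<dots> = (\<Sum>j<m. ip k (r j) (r j))" unfolding ip_def by (rule sum.swap)
  also have "\<dots> = of_nat m" using r by (simp add: orthonormal_def)
  finally show False using \<open>m < k\<close> by simp
qed

lemma orthonormal_completion: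
  assumes r: "orthonormal k m r" and "m \<le> k"
  shows "\<exists>r'. orthonormal k k r' \<and> (\<forall>i<m. r' i = r i)"
proof -
  have "\<exists>r'. orthonormal k p r' \<and> (\<forall>i<m. r' i = r i)" if "m \<le> p" "p \<le> k" for p
    using that
  proof (induction p rule: dec_induct)
    case base
    then show ?case using r by blast
  next
    case (step p)
    then obtain r' where r': "orthonormal k p r'" "\<forall>i<m. r' i = r i" by auto
    obtain x where x: "ip k x x \<noteq> 0" "\<forall>i<p. ip k x (r' i) = 0"
      using exists_orthogonal_vector[OF r'(1)] step.prems by auto
    have "ip k (normalized k x) (r' i) = 0" if "i < p" for i
      using x(2) that by (simp add: ip_normalized_left)
    then have "orthonormal k (Suc p) (r'(p := normalized k x))"
      using x(1) by (intro orthonormal_Suc[OF r'(1)]) (simp_all add: ip_normalized)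
    moreover have "\<forall>i<m. (r'(p := normalized k x)) i = r i" using r'(2) step.hyps by simp
    ultimately show ?case by blast
  qed
  from this[OF \<open>m \<le> k\<close>] show ?thesis by simp
qed


section \<open>Adjoint matrices\<close>

lemma dim_mat_adjoint [simp]:
  "dim_row (mat_adjoint A) = dim_col A" "dim_col (mat_adjoint A) = dim_row A"
  by (simp_all add: mat_adjoint_def)

lemma mat_adjoint_carrier [simp]: "A \<in> carrier_mat r c \<Longrightarrow> mat_adjoint A \<in> carrier_mat c r"
  by (intro carrier_matI) simp_all

lemma index_mat_adjoint [simp]:
  "i < dim_col A \<Longrightarrow> j < dim_row A \<Longrightarrow> mat_adjoint A $$ (i, j) = conjugate (A $$ (j, i))"
  by (simp add: mat_adjoint_def mat_of_rows_index)

lemma index_mult_sum: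
  assumes "A \<in> carrier_mat r m" "B \<in> carrier_mat m c" "i < r" "j < c"
  shows "(A * B) $$ (i, j) = (\<Sum>l<m. A $$ (i, l) * B $$ (l, j))"
  using assms by (auto simp: scalar_prod_def lessThan_atLeast0)

lemma index_mult_adjoint:
  fixes A B :: "'e::conj_normed_field mat"
  assumes "A \<in> carrier_mat r m" "B \<in> carrier_mat c m" "i < r" "j < c"
  shows "(A * mat_adjoint B) $$ (i, j) = ip m (\<lambda>l. A $$ (i, l)) (\<lambda>l. B $$ (j, l))"
  using assms by (subst index_mult_sum[where m=m and r=r and c=c]) (auto simp: ip_def)

lemma mat_adjoint_adjoint [simp]: "mat_adjoint (mat_adjoint A) = A"
  by (rule eq_matI) simp_all

lemma mat_adjoint_mult:
  fixes A B :: "'e::conjugatable_field mat"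
  assumes "A \<in> carrier_mat r m" "B \<in> carrier_mat m c"
  shows "mat_adjoint (A * B) = mat_adjoint B * mat_adjoint A"
proof (rule eq_matI)
  fix i j
  assume "i < dim_row (mat_adjoint B * mat_adjoint A)" "j < dim_col (mat_adjoint B * mat_adjoint A)"
  then have ij: "i < c" "j < r" using assms by auto
  have "mat_adjoint (A * B) $$ (i, j) = conjugate ((A * B) $$ (j, i))"
    using ij assms by (intro index_mat_adjoint) auto
  also have "\<dots> = conjugate (\<Sum>l<m. A $$ (j, l) * B $$ (l, i))"
    using ij assms by (subst index_mult_sum[OF assms]) auto
  also have "\<dots> = (\<Sum>l<m. mat_adjoint B $$ (i, l) * mat_adjoint A $$ (l, j))"
    using ij assms by (simp add: sum_conjugate conjugate_dist_mul mult.commute)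
  also have "\<dots> = (mat_adjoint B * mat_adjoint A) $$ (i, j)"
    by (rule index_mult_sum[symmetric]) (use ij assms in auto)
  finally show "mat_adjoint (A * B) $$ (i, j) = (mat_adjoint B * mat_adjoint A) $$ (i, j)" .
qed (use assms in auto)

lemma mat_adjoint_smult:
  fixes A :: "'e::conj_normed_field mat"
  shows "mat_adjoint (of_real c \<cdot>\<^sub>m A) = of_real c \<cdot>\<^sub>m mat_adjoint A"
  by (rule eq_matI) (auto simp: conjugate_dist_mul)

lemma mat_adjoint_one [simp]: "mat_adjoint (1\<^sub>m n :: 'e::conj_normed_field mat) = 1\<^sub>m n"
  by (rule eq_matI) auto

lemma mat_adjoint_minus:
  fixes A B :: "'e::conj_normed_field mat"
  assumes "A \<in> carrier_mat r c" "B \<in> carrier_mat r c"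
  shows "mat_adjoint (A - B) = mat_adjoint A - mat_adjoint B"
  using assms by (intro eq_matI) (auto simp: conjugate_diff)

lemma app_mult:
  assumes "A \<in> carrier_mat r m" "B \<in> carrier_mat m c" "i < r"
  shows "app c (A * B) x i = app m A (app c B x) i"
proof -
  have "app c (A * B) x i = (\<Sum>l<c. \<Sum>p<m. A $$ (i, p) * (B $$ (p, l) * x l))"
    using assms by (simp add: app_def index_mult_sum[OF assms(1,2)] sum_distrib_right mult.assoc
        del: index_mult_mat)
  also have "\<dots> = (\<Sum>p<m. \<Sum>l<c. A $$ (i, p) * (B $$ (p, l) * x l))" by (rule sum.swap)
  finally show ?thesis by (simp add: app_def sum_distrib_left)
qed

lemma ip_app:
  assumes "A \<in> carrier_mat r c"
  shows "ip r (app c A x) y = ip c x (app r (mat_adjoint A) y)"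
proof -
  have "ip r (app c A x) y = (\<Sum>i<r. \<Sum>l<c. A $$ (i, l) * x l * conjugate (y i))"
    by (simp add: ip_def app_def sum_distrib_right)
  also have "\<dots> = (\<Sum>l<c. \<Sum>i<r. A $$ (i, l) * x l * conjugate (y i))" by (rule sum.swap)
  also have "\<dots> = ip c x (app r (mat_adjoint A) y)"
    using assms by (auto simp: ip_def app_def sum_conjugate conjugate_dist_mul sum_distrib_left
        mult_ac intro!: sum.cong)
  finally show ?thesis .
qed

lemma mat_eqI_app:
  fixes A B :: "'e::conj_normed_field mat"
  assumes "A \<in> carrier_mat r c" "B \<in> carrier_mat r c"
    and "\<And>x i. i < r \<Longrightarrow> app c A x i = app c B x i"
  shows "A = B"
proof (rule eq_matI)
  fix i j assume "i < dim_row B" "j < dim_col B"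
  then show "A $$ (i, j) = B $$ (i, j)"
    using assms(1,2) assms(3)[of i "\<lambda>l. if l = j then 1 else 0"]
    by (simp add: app_unit)
qed (use assms(1,2) in auto)

text \<open>Polarisation for Hermitian forms: $\langle H(x+Hx),x+Hx\rangle=0$ gives
  $2\langle Hx,Hx\rangle=0$.\<close>

lemma hermitian_form_zero:
  fixes H :: "'e::conj_normed_field mat"
  assumes H: "H \<in> carrier_mat n n" "mat_adjoint H = H"
    and zero: "\<And>x. ip n (app n H x) x = 0"
    and i: "i < n"
  shows "app n H x i = 0"
proof -
  define y where "y = app n H x"
  have "app n H (\<lambda>l. x l + y l) = (\<lambda>l. app n H x l + app n H y l)"
    by (rule ext) (rule app_add)
  then have "ip n (app n H x) x + ip n (app n H x) y + (ip n (app n H y) x + ip n (app n H y) y) = 0"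
    using zero[of "\<lambda>l. x l + y l"] by (simp add: ip_add_left ip_add_right)
  moreover have "ip n (app n H y) x = ip n y y"
    using ip_app[OF H(1), of y x] H(2) by (simp add: y_def)
  ultimately have "ip n y y + ip n y y = 0"
    unfolding y_def[symmetric] zero[of x, folded y_def] zero[of y] by simp
  then have "ip n y y = 0" unfolding mult_2[symmetric] by simp
  then show ?thesis using i by (simp add: ip_self_eq_0 y_def)
qed

lemma hermitian_eqI:
  fixes A B :: "'e::conj_normed_field mat"
  assumes A: "A \<in> carrier_mat n n" "mat_adjoint A = A"
    and B: "B \<in> carrier_mat n n" "mat_adjoint B = B"
    and eq: "\<And>x. ip n (app n A x) x = ip n (app n B x) x"
  shows "A = B"
proof (rule mat_eqI_app[OF A(1) B(1)])
  fix x :: "nat \<Rightarrow> 'e" and i assume i: "i < n"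
  have diff: "app n (A - B) x l = app n A x l - app n B x l" if "l < n" for x :: "nat \<Rightarrow> 'e" and l
    using A B that by (simp add: app_def left_diff_distrib sum_subtractf)
  have "ip n (app n (A - B) x) x = 0" for x
  proof -
    have "ip n (app n (A - B) x) x = ip n (\<lambda>l. app n A x l - app n B x l) x"
      by (rule ip_cong) (simp_all add: diff)
    then show ?thesis by (simp add: ip_diff_left eq)
  qed
  then have "app n (A - B) x i = 0"
    using A B i by (intro hermitian_form_zero) (auto simp: mat_adjoint_minus)
  then show "app n A x i = app n B x i" using i by (simp add: diff)
qed


section \<open>Continuity of matrix operations\<close>

lemma continuous_map_mult:
  fixes f g :: "'x \<Rightarrow> 'e::real_normed_algebra"
  assumes "continuous_map X euclidean f" "continuous_map X euclidean g"
  shows "continuous_map X euclidean (\<lambda>x. f x * g x)"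
  using assms by (simp add: continuous_map_atin tendsto_mult)

lemma continuous_map_conjugate:
  fixes f :: "'x \<Rightarrow> 'e::conj_normed_field"
  assumes "continuous_map X euclidean f"
  shows "continuous_map X euclidean (\<lambda>x. conjugate (f x))"
  using assms by (simp add: continuous_map_atin tendsto_conjugate)

lemma continuous_map_of_real:
  assumes "continuous_map X euclidean f"
  shows "continuous_map X euclidean (\<lambda>x. of_real (f x) :: 'e::real_normed_algebra_1)"
  using assms by (simp add: continuous_map_atin tendsto_of_real)

lemma continuous_map_sum_lessThan:
  fixes f :: "nat \<Rightarrow> 'x \<Rightarrow> 'e::real_normed_vector"
  assumes "\<And>l. l < k \<Longrightarrow> continuous_map X euclidean (f l)"
  shows "continuous_map X euclidean (\<lambda>x. \<Sum>l<k. f l x)"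
  by (rule continuous_map_sum) (use assms in auto)

lemma continuous_map_mat_topology_iff:
  "continuous_map X (mat_topology r c) f \<longleftrightarrow>
     (\<forall>x\<in>topspace X. f x \<in> carrier_mat r c) \<and>
     (\<forall>i<r. \<forall>j<c. continuous_map X euclidean (\<lambda>x. f x $$ (i, j)))"
    (is "?lhs \<longleftrightarrow> ?rhs")
proof
  let ?I = "{..<r} \<times> {..<c}"
  let ?e = "\<lambda>A. restrict (\<lambda>(i, j). A $$ (i, j)) ?I"
  let ?P = "product_topology (\<lambda>_. euclidean :: 'b topology) ?I"
  assume L: ?lhs
  have "continuous_map (mat_topology r c) ?P (id \<circ> ?e)"
    unfolding mat_topology_def by (rule continuous_map_pullback) simp
  then have e: "continuous_map X ?P (?e \<circ> f)"
    using continuous_map_compose[OF L] by simp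
  have "continuous_map X euclidean (\<lambda>x. f x $$ (i, j))" if "i < r" "j < c" for i j
  proof -
    have "continuous_map X euclidean (\<lambda>x. (?e \<circ> f) x (i, j))"
      using e that unfolding continuous_map_componentwise by blast
    then show ?thesis using that by simp
  qed
  then show ?rhs using L by (auto simp: continuous_map_def)
next
  assume R: ?rhs
  show ?lhs
    unfolding mat_topology_def
  proof (rule continuous_map_pullback')
    show "topspace X \<subseteq> f -` carrier_mat r c" using R by auto
    show "continuous_map X (product_topology (\<lambda>_. euclidean) ({..<r} \<times> {..<c}))
        ((\<lambda>A. restrict (\<lambda>(i, j). A $$ (i, j)) ({..<r} \<times> {..<c})) \<circ> f)"
      using R by (auto simp: continuous_map_componentwise)
  qed
qed

lemma continuous_map_mat_mult:
  fixes f g :: "'x \<Rightarrow> 'e::{comm_ring, real_normed_algebra} mat"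
  assumes "continuous_map X (mat_topology r m) f" "continuous_map X (mat_topology m c) g"
  shows "continuous_map X (mat_topology r c) (\<lambda>x. f x * g x)"
  unfolding continuous_map_mat_topology_iff
proof (intro conjI ballI allI impI)
  note fg = assms[unfolded continuous_map_mat_topology_iff]
  show "f x * g x \<in> carrier_mat r c" if "x \<in> topspace X" for x
    using fg that by (meson mult_carrier_mat)
  fix i j assume ij: "i < r" "j < c"
  have "continuous_map X euclidean (\<lambda>x. \<Sum>l<m. f x $$ (i, l) * g x $$ (l, j))"
    using fg ij by (intro continuous_map_sum_lessThan continuous_map_mult) auto
  moreover have "(\<Sum>l<m. f x $$ (i, l) * g x $$ (l, j)) = (f x * g x) $$ (i, j)"
    if "x \<in> topspace X" for x
    using fg ij that by (intro index_mult_sum[symmetric]) auto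
  ultimately show "continuous_map X euclidean (\<lambda>x. (f x * g x) $$ (i, j))"
    by (rule continuous_map_eq)
qed

lemma continuous_map_mat_adjoint:
  fixes f :: "'x \<Rightarrow> 'e::conj_normed_field mat"
  assumes "continuous_map X (mat_topology r c) f"
  shows "continuous_map X (mat_topology c r) (\<lambda>x. mat_adjoint (f x))"
  unfolding continuous_map_mat_topology_iff
proof (intro conjI ballI allI impI)
  note f = assms[unfolded continuous_map_mat_topology_iff]
  show "mat_adjoint (f x) \<in> carrier_mat c r" if "x \<in> topspace X" for x
    using f that by simp
  fix i j assume ij: "i < c" "j < r"
  have "continuous_map X euclidean (\<lambda>x. conjugate (f x $$ (j, i)))"
    using f ij by (intro continuous_map_conjugate) auto
  moreover have "conjugate (f x $$ (j, i)) = mat_adjoint (f x) $$ (i, j)"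
    if "x \<in> topspace X" for x
    using f ij that by (intro index_mat_adjoint[symmetric]) auto
  ultimately show "continuous_map X euclidean (\<lambda>x. mat_adjoint (f x) $$ (i, j))"
    by (rule continuous_map_eq)
qed

lemma continuous_map_mat_smult:
  fixes f :: "'x \<Rightarrow> 'e::{comm_ring, real_normed_algebra} mat"
  assumes "continuous_map X (mat_topology r c) f"
  shows "continuous_map X (mat_topology r c) (\<lambda>x. s \<cdot>\<^sub>m f x)"
  unfolding continuous_map_mat_topology_iff
proof (intro conjI ballI allI impI)
  note f = assms[unfolded continuous_map_mat_topology_iff]
  show "s \<cdot>\<^sub>m f x \<in> carrier_mat r c" if "x \<in> topspace X" for x
    using f that by simp
  fix i j assume ij: "i < r" "j < c"
  have "continuous_map X euclidean (\<lambda>x. s * f x $$ (i, j))"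
    using f ij by (intro continuous_map_mult) auto
  moreover have "s * f x $$ (i, j) = (s \<cdot>\<^sub>m f x) $$ (i, j)" if "x \<in> topspace X" for x
    using f ij that by (intro index_smult_mat(1)[symmetric]) auto
  ultimately show "continuous_map X euclidean (\<lambda>x. (s \<cdot>\<^sub>m f x) $$ (i, j))"
    by (rule continuous_map_eq)
qed

lemma continuous_map_mat_const:
  "A \<in> carrier_mat r c \<Longrightarrow> continuous_map X (mat_topology r c) (\<lambda>_. A)"
  by simp

lemma continuous_map_ip:
  assumes "\<And>l. l < k \<Longrightarrow> continuous_map X euclidean (\<lambda>y. x y l)"
    and "\<And>l. l < k \<Longrightarrow> continuous_map X euclidean (\<lambda>y. z y l)"
  shows "continuous_map X euclidean (\<lambda>y. ip k (x y) (z y))"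
  unfolding ip_def using assms
  by (intro continuous_map_sum_lessThan continuous_map_mult continuous_map_conjugate)

lemma continuous_map_app:
  assumes "continuous_map X (mat_topology r k) M" "i < r"
    and "\<And>l. l < k \<Longrightarrow> continuous_map X euclidean (\<lambda>y. x y l)"
  shows "continuous_map X euclidean (\<lambda>y. app k (M y) (x y) i)"
  unfolding app_def using assms
  by (intro continuous_map_sum_lessThan continuous_map_mult)
    (auto simp: continuous_map_mat_topology_iff)


section \<open>Continuous local diagonalisation of Hermitian matrices with constant spectrum\<close>

text \<open>The $k\times k$ diagonal matrix with the real entries \<open>d 0, \<dots>, d (k - 1)\<close>.\<close>

definition real_diag :: "nat \<Rightarrow> (nat \<Rightarrow> real) \<Rightarrow> 'e::conj_normed_field mat" where
  "real_diag k d = mat k k (\<lambda>(i, j). if i = j then of_real (d i) else 0)"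

lemma real_diag_carrier [simp]: "real_diag k d \<in> carrier_mat k k"
  by (simp add: real_diag_def)

lemma app_real_diag: "i < k \<Longrightarrow> app k (real_diag k d) x i = of_real (d i) * x i"
  by (simp add: app_def real_diag_def if_distrib[of "\<lambda>c. c * _"] cong: if_cong)

lemma mat_adjoint_real_diag [simp]: "mat_adjoint (real_diag k d) = real_diag k d"
  by (rule eq_matI) (auto simp: real_diag_def)

lemma unitary_groupD:
  assumes "U \<in> unitary_group k"
  shows "U \<in> carrier_mat k k" "mat_adjoint U * U = 1\<^sub>m k" "U * mat_adjoint U = 1\<^sub>m k"
  using assms by (auto simp: unitary_group_def)

lemma unitary_groupI:
  fixes U :: "'e::conjugatable_field mat"
  assumes "U \<in> carrier_mat k k" "U * mat_adjoint U = 1\<^sub>m k"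
  shows "U \<in> unitary_group k"
  using assms mat_mult_left_right_inverse[OF assms(1) _ assms(2)] by (simp add: unitary_group_def)

lemma conjugate_real_diag_carrier [simp]:
  "A \<in> carrier_mat r c \<Longrightarrow> mat_adjoint A * real_diag r d * A \<in> carrier_mat c c"
  by (intro mult_carrier_mat[of _ c r] mult_carrier_mat[of _ c r]) simp_all

lemma unitary_conjugate_hermitian:
  assumes "U \<in> unitary_group k"
  shows "mat_adjoint (mat_adjoint U * real_diag k d * U) = mat_adjoint U * real_diag k d * U"
proof -
  note U' = unitary_groupD[OF assms]
  have c: "mat_adjoint U * real_diag k d \<in> carrier_mat k k"
    using U' by (intro mult_carrier_mat[of _ k k]) auto
  have "mat_adjoint (mat_adjoint U * real_diag k d * U) =
      mat_adjoint U * mat_adjoint (mat_adjoint U * real_diag k d)"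
    by (rule mat_adjoint_mult[OF c U'(1)])
  also have "mat_adjoint (mat_adjoint U * real_diag k d) = real_diag k d * U"
    using mat_adjoint_mult[OF mat_adjoint_carrier[OF U'(1)] real_diag_carrier] by simp
  finally show ?thesis
    using assoc_mult_mat[OF mat_adjoint_carrier[OF U'(1)] real_diag_carrier U'(1)] by simp
qed

lemma orthonormal_rows:
  assumes "U \<in> unitary_group k"
  shows "orthonormal k k (\<lambda>i l. U $$ (i, l))"
  using unitary_groupD[OF assms]
  by (auto simp: orthonormal_def simp flip: index_mult_adjoint[where r=k and c=k])

text \<open>The rows of a unitary \<open>U\<close> with $M=U^*\Delta U$ are the conjugates of eigenvectors of \<open>M\<close>.\<close>

lemma app_row_conjugate:
  fixes U :: "'e::conj_normed_field mat"
  assumes U: "U \<in> unitary_group k" and i: "i < k" and l: "l < k"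
  shows "app k (mat_adjoint U * real_diag k d * U) (\<lambda>l. conjugate (U $$ (i, l))) l =
    of_real (d i) * conjugate (U $$ (i, l))"
proof -
  note U' = unitary_groupD[OF U]
  define e where "e = (\<lambda>j. if j = i then 1 else 0 :: 'e)"
  have row: "app k U (\<lambda>l. conjugate (U $$ (i, l))) j = e j" if "j < k" for j
    using orthonormal_rows[OF U] that i by (auto simp: orthonormal_def e_def app_def ip_def)
  have "app k (mat_adjoint U * real_diag k d * U) (\<lambda>l. conjugate (U $$ (i, l))) l =
      app k (mat_adjoint U * real_diag k d) e l"
    using U' l row mult_carrier_mat[of "mat_adjoint U" k k "real_diag k d" k]
    by (subst app_mult[of _ k k]) (auto intro: app_cong)
  also have "\<dots> = app k (mat_adjoint U) (app k (real_diag k d) e) l"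
    using U' l by (intro app_mult) auto
  also have "\<dots> = app k (mat_adjoint U) (\<lambda>j. of_real (d i) * e j) l"
    by (rule app_cong) (auto simp: app_real_diag e_def)
  also have "\<dots> = of_real (d i) * mat_adjoint U $$ (l, i)"
    unfolding app_scale using i by (simp add: e_def app_unit)
  finally show ?thesis using U' i l by simp
qed

lemma eigenvector_matrix:
  fixes M :: "'e::conj_normed_field mat"
  assumes M: "M \<in> carrier_mat k k" and r: "orthonormal k k r"
    and eig: "\<And>i l. i < k \<Longrightarrow> l < k \<Longrightarrow> app k M (r i) l = of_real (d i) * r i l"
  defines "U \<equiv> mat k k (\<lambda>(i, l). conjugate (r i l))"
  shows "U \<in> unitary_group k" "M = mat_adjoint U * real_diag k d * U"
proof -
  have Uc: "U \<in> carrier_mat k k" by (simp add: U_def)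
  have "U * mat_adjoint U = 1\<^sub>m k"
  proof (rule eq_matI)
    fix i j assume "i < dim_row (1\<^sub>m k :: 'e mat)" "j < dim_col (1\<^sub>m k :: 'e mat)"
    then have ij: "i < k" "j < k" by auto
    have "(U * mat_adjoint U) $$ (i, j) = ip k (\<lambda>l. U $$ (i, l)) (\<lambda>l. U $$ (j, l))"
      by (rule index_mult_adjoint[OF Uc Uc ij])
    also have "\<dots> = ip k (r j) (r i)"
      using ij by (simp add: ip_def U_def mult.commute)
    finally show "(U * mat_adjoint U) $$ (i, j) = 1\<^sub>m k $$ (i, j)"
      using r ij by (simp add: orthonormal_def)
  qed (use Uc in auto)
  then show U: "U \<in> unitary_group k" by (rule unitary_groupI[OF Uc])
  note U' = unitary_groupD[OF U]
  have "M * mat_adjoint U = mat_adjoint U * real_diag k d"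
  proof (rule eq_matI)
    fix l i
    assume "l < dim_row (mat_adjoint U * real_diag k d :: 'e mat)"
      "i < dim_col (mat_adjoint U * real_diag k d :: 'e mat)"
    then have il: "i < k" "l < k" using Uc by (auto simp: real_diag_def)
    have "(M * mat_adjoint U) $$ (l, i) = app k M (r i) l"
      using M Uc il by (subst index_mult_sum[where m=k and r=k and c=k]) (auto simp: app_def U_def)
    also have "\<dots> = (mat_adjoint U * real_diag k d) $$ (l, i)"
      using Uc il by (subst index_mult_sum[where m=k and r=k and c=k])
        (auto simp: eig U_def real_diag_def if_distrib[of "\<lambda>c. _ * c"] cong: if_cong)
    finally show "(M * mat_adjoint U) $$ (l, i) = (mat_adjoint U * real_diag k d) $$ (l, i)" .
  qed (use M Uc in \<open>auto simp: real_diag_def\<close>)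
  then have "(M * mat_adjoint U) * U = mat_adjoint U * real_diag k d * U" by simp
  moreover have "(M * mat_adjoint U) * U = M"
    using M U' assoc_mult_mat[OF M mat_adjoint_carrier[OF Uc] Uc] by simp
  ultimately show "M = mat_adjoint U * real_diag k d * U" by simp
qed

text \<open>\<open>shift_prod k M ms x\<close> is $\prod_{\mu}(M-\mu)\,x$, with $\mu$ running through the list \<open>ms\<close>.\<close>

primrec shift_prod ::
    "nat \<Rightarrow> 'e mat \<Rightarrow> real list \<Rightarrow> (nat \<Rightarrow> 'e) \<Rightarrow> nat \<Rightarrow> 'e::conj_normed_field" where
  "shift_prod k M [] x = x"
| "shift_prod k M (\<mu> # ms) x =
     (\<lambda>i. app k M (shift_prod k M ms x) i - of_real \<mu> * shift_prod k M ms x i)"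

text \<open>The matrix is Hermitian, so $\langle p(M)x,r\rangle=\langle x,p(M)r\rangle=p(d)\langle x,r\rangle$
  for an eigenvector \<open>r\<close> with the real eigenvalue \<open>d\<close>.\<close>

lemma ip_shift_prod:
  assumes M: "M \<in> carrier_mat k k" "mat_adjoint M = M"
    and r: "\<And>l. l < k \<Longrightarrow> app k M r l = of_real d * r l"
  shows "ip k (shift_prod k M ms x) r = of_real (\<Prod>\<mu>\<leftarrow>ms. d - \<mu>) * ip k x r"
proof (induction ms)
  case (Cons \<mu> ms)
  let ?w = "shift_prod k M ms x"
  have "ip k (app k M ?w) r = ip k ?w (app k M r)"
    using ip_app[OF M(1)] M(2) by simp
  also have "\<dots> = ip k ?w (\<lambda>l. of_real d * r l)" by (rule ip_cong) (simp_all add: r)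
  finally have "ip k (shift_prod k M (\<mu> # ms) x) r = (of_real d - of_real \<mu>) * ip k ?w r"
    by (simp add: ip_diff_left ip_scale_left ip_scale_right left_diff_distrib)
  then show ?case by (simp add: Cons.IH mult.assoc)
qed simp

lemma continuous_map_shift_prod:
  assumes M: "continuous_map X (mat_topology k k) M"
    and x: "\<And>l. l < k \<Longrightarrow> continuous_map X euclidean (\<lambda>y. x y l)" and "i < k"
  shows "continuous_map X euclidean (\<lambda>y. shift_prod k (M y) ms (x y) i)"
  using \<open>i < k\<close>
proof (induction ms arbitrary: i)
  case (Cons \<mu> ms)
  then show ?case using M
    by (auto intro!: continuous_map_diff continuous_map_mult continuous_map_app)
qed (simp add: x)

text \<open>The conjugated rows of a unitary matrix span: only zero is orthogonal to all of them.\<close>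

lemma zero_if_orthogonal_to_rows:
  fixes U :: "'e::conj_normed_field mat"
  assumes U: "U \<in> unitary_group k" and l: "l < k"
    and zero: "\<And>i. i < k \<Longrightarrow> ip k x (\<lambda>l. conjugate (U $$ (i, l))) = 0"
  shows "x l = 0"
proof -
  note U' = unitary_groupD[OF U]
  have "app k U x i = 0" if "i < k" for i
    using zero[OF that] by (simp add: ip_def app_def mult.commute)
  then have "app k (mat_adjoint U) (app k U x) l = 0" by (simp add: app_def)
  then have "app k (mat_adjoint U * U) x l = 0"
    using app_mult[of "mat_adjoint U" k k U k l x] U' l by simp
  then have "app k (1\<^sub>m k) x l = 0" using U' by simp
  then show ?thesis using l by (simp add: app_def if_distrib[of "\<lambda>c. c * _"] cong: if_cong)
qed

text \<open>If \<open>d0\<close> and \<open>ms\<close> together exhaust the spectrum, then the product of the shifts by \<open>ms\<close> maps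
  into the eigenspace of \<open>d0\<close>.\<close>

lemma shift_prod_eigenvector:
  fixes U :: "'e::conj_normed_field mat"
  assumes U: "U \<in> unitary_group k" and M: "M = mat_adjoint U * real_diag k d * U"
    and spec: "d ` {..<k} \<subseteq> insert d0 (set ms)" and l: "l < k"
  shows "app k M (shift_prod k M ms x) l = of_real d0 * shift_prod k M ms x l"
proof -
  note U' = unitary_groupD[OF U]
  have Mc: "M \<in> carrier_mat k k" using U' M by auto
  have Ma: "mat_adjoint M = M" unfolding M by (rule unitary_conjugate_hermitian[OF U])
  have "shift_prod k M (d0 # ms) x l = 0"
  proof (rule zero_if_orthogonal_to_rows[OF U l])
    fix i assume i: "i < k"
    have "ip k (shift_prod k M (d0 # ms) x) (\<lambda>l. conjugate (U $$ (i, l))) =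
        of_real (\<Prod>\<mu>\<leftarrow>d0 # ms. d i - \<mu>) * ip k x (\<lambda>l. conjugate (U $$ (i, l)))"
      using i app_row_conjugate[OF U] by (intro ip_shift_prod[OF Mc Ma]) (simp add: M)
    moreover have "d i \<in> set (d0 # ms)" using spec i by auto
    then have "(\<Prod>\<mu>\<leftarrow>d0 # ms. d i - \<mu>) = 0" by (auto simp: prod_list_zero_iff)
    ultimately show "ip k (shift_prod k M (d0 # ms) x) (\<lambda>l. conjugate (U $$ (i, l))) = 0" by simp
  qed
  then show ?thesis by simp
qed

lemma continuous_map_normalized:
  fixes x :: "'y \<Rightarrow> nat \<Rightarrow> 'e::conj_normed_field"
  assumes x: "\<And>l. l < k \<Longrightarrow> continuous_map X euclidean (\<lambda>y. x y l)" and "i < k"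
    and nz: "\<And>y. y \<in> topspace X \<Longrightarrow> ip k (x y) (x y) \<noteq> 0"
  shows "continuous_map X euclidean (\<lambda>y. normalized k (x y) i)"
proof -
  have "continuous_map X euclidean (\<lambda>y. \<Sum>l<k. (norm (x y l))\<^sup>2)"
    using x by (intro continuous_map_sum_lessThan continuous_map_real_pow continuous_map_norm)
  then have "continuous_map X euclidean (\<lambda>y. inverse (sqrt (\<Sum>l<k. (norm (x y l))\<^sup>2)))"
  proof (intro continuous_map_real_inverse)
    assume "continuous_map X euclidean (\<lambda>y. \<Sum>l<k. (norm (x y l))\<^sup>2)"
    then show "continuous_map X euclidean (\<lambda>y. sqrt (\<Sum>l<k. (norm (x y l))\<^sup>2))"
      by (simp add: continuous_map_atin tendsto_real_sqrt)
    show "sqrt (\<Sum>l<k. (norm (x y l))\<^sup>2) \<noteq> 0" if "y \<in> topspace X" for y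
      using nz[OF that] by (auto simp: ip_self simp del: of_real_sum of_real_power)
  qed
  then show ?thesis unfolding normalized_def
    using x \<open>i < k\<close> by (intro continuous_map_mult continuous_map_of_real) auto
qed

text \<open>The state of the parametrised Gram-Schmidt process after \<open>m\<close> steps: on the open set \<open>W\<close>, the
  vectors \<open>r 0 y, \<dots>, r (m - 1) y\<close> depend continuously on \<open>y\<close> and form an orthonormal family of
  eigenvectors of \<open>M y\<close>. The vectors \<open>f i\<close> are an eigenbasis at the
  base point \<open>y0\<close>. The last clause keeps \<open>r j y0\<close> orthogonal to the basis vectors that
  are still to be used, which makes the next residual nonzero at \<open>y0\<close>.\<close>

definition partial_eigenframe ::
    "'y topology \<Rightarrow> nat \<Rightarrow> ('y \<Rightarrow> 'e mat) \<Rightarrow> (nat \<Rightarrow> real) \<Rightarrow> 'y \<Rightarrow> (nat \<Rightarrow> nat \<Rightarrow> 'e) \<Rightarrow>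
      nat \<Rightarrow> 'y set \<Rightarrow> (nat \<Rightarrow> 'y \<Rightarrow> nat \<Rightarrow> 'e::conj_normed_field) \<Rightarrow> bool" where
  "partial_eigenframe Y k M d y0 f m W r \<longleftrightarrow>
     openin Y W \<and> y0 \<in> W \<and>
     (\<forall>j<m. \<forall>l<k. continuous_map (subtopology Y W) euclidean (\<lambda>y. r j y l)) \<and>
     (\<forall>y\<in>W. orthonormal k m (\<lambda>j. r j y)) \<and>
     (\<forall>y\<in>W. \<forall>j<m. \<forall>l<k. app k (M y) (r j y) l = of_real (d j) * r j y l) \<and>
     (\<forall>j<m. \<forall>i. m \<le> i \<longrightarrow> i < k \<longrightarrow> ip k (r j y0) (f i) = 0)"

lemma partial_eigenframeD:
  assumes "partial_eigenframe Y k M d y0 f m W r"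
  shows "openin Y W" "y0 \<in> W"
    and "\<And>j l. j < m \<Longrightarrow> l < k \<Longrightarrow> continuous_map (subtopology Y W) euclidean (\<lambda>y. r j y l)"
    and "\<And>y. y \<in> W \<Longrightarrow> orthonormal k m (\<lambda>j. r j y)"
    and "\<And>y j l. y \<in> W \<Longrightarrow> j < m \<Longrightarrow> l < k \<Longrightarrow> app k (M y) (r j y) l = of_real (d j) * r j y l"
    and "\<And>i j. j < m \<Longrightarrow> m \<le> i \<Longrightarrow> i < k \<Longrightarrow> ip k (r j y0) (f i) = 0"
  using assms by (simp_all add: partial_eigenframe_def)

lemma partial_eigenframe_step:
  fixes M :: "'y \<Rightarrow> 'e::conj_normed_field mat"
  assumes M: "continuous_map Y (mat_topology k k) M"
    and diag: "\<And>y. y \<in> topspace Y \<Longrightarrow>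
        \<exists>U\<in>unitary_group k. M y = mat_adjoint U * real_diag k d * U"
    and f: "orthonormal k k f"
      "\<And>i l. i < k \<Longrightarrow> l < k \<Longrightarrow> app k (M y0) (f i) l = of_real (d i) * f i l"
    and r: "partial_eigenframe Y k M d y0 f m W r" and m: "m < k"
  shows "\<exists>W' r'. partial_eigenframe Y k M d y0 f (Suc m) W' r'"
proof -
  note W = partial_eigenframeD(1,2)[OF r]
  note r_cont = partial_eigenframeD(3)[OF r]
  note r_on = partial_eigenframeD(4)[OF r]
  note r_eig = partial_eigenframeD(5)[OF r]
  note r_orth = partial_eigenframeD(6)[OF r]
  have WY: "W \<subseteq> topspace Y" using W(1) by (rule openin_subset)
  have M_herm: "M y \<in> carrier_mat k k \<and> mat_adjoint (M y) = M y" if yY: "y \<in> topspace Y" for y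
  proof -
    obtain U where U: "U \<in> unitary_group k" and My: "M y = mat_adjoint U * real_diag k d * U"
      using diag[OF yY] by blast
    show ?thesis unfolding My using unitary_groupD[OF U] unitary_conjugate_hermitian[OF U] by simp
  qed
  \<comment> \<open>The eigenvalues other than \<open>d m\<close>, whose shifts annihilate every
    eigenspace except that of \<open>d m\<close>.\<close>
  obtain ms where ms: "set ms = d ` {..<k} - {d m}"
    using finite_list[of "d ` {..<k} - {d m}"] by auto
  define u where "u = (\<lambda>y. residual k m (\<lambda>j. r j y) (f m))"
  define g where "g = (\<lambda>y. shift_prod k (M y) ms (u y))"
  define W' where "W' = {y \<in> W. (\<Sum>l<k. (norm (g y l))\<^sup>2) \<noteq> 0}"
  define r' where "r' = (\<lambda>j y. if j < m then r j y else normalized k (g y))"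
  have W'W: "W' \<subseteq> W" by (auto simp: W'_def)
  have g_nz: "ip k (g y) (g y) \<noteq> 0" if "y \<in> W'" for y
    using that by (simp add: W'_def ip_self del: of_real_sum of_real_power)
  have u_cont: "continuous_map (subtopology Y W) euclidean (\<lambda>y. u y l)" if "l < k" for l
    unfolding u_def residual_def using that
    by (intro continuous_map_diff continuous_map_sum_lessThan continuous_map_mult continuous_map_ip
        r_cont) auto
  have g_cont: "continuous_map (subtopology Y W) euclidean (\<lambda>y. g y l)" if "l < k" for l
    unfolding g_def
    by (rule continuous_map_shift_prod) (use M u_cont that in \<open>auto intro: continuous_map_from_subtopology\<close>)
  have "continuous_map (subtopology Y W) euclidean (\<lambda>y. \<Sum>l<k. (norm (g y l))\<^sup>2)"
    by (intro continuous_map_sum_lessThan continuous_map_real_pow continuous_map_norm g_cont)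
  then have "openin (subtopology Y W)
      {y \<in> topspace (subtopology Y W). (\<Sum>l<k. (norm (g y l))\<^sup>2) \<in> - {0}}"
    by (rule openin_continuous_map_preimage) (simp add: open_Compl)
  moreover have "{y \<in> topspace (subtopology Y W). (\<Sum>l<k. (norm (g y l))\<^sup>2) \<in> - {0}} = W'"
    using WY by (auto simp: W'_def)
  ultimately have W'_open: "openin Y W'"
    using openin_trans_full[OF _ W(1)] by simp
  have g_ip: "ip k (g y) e = of_real (\<Prod>\<mu>\<leftarrow>ms. c - \<mu>) * ip k (u y) e"
    if "y \<in> W" "\<And>l. l < k \<Longrightarrow> app k (M y) e l = of_real c * e l" for y e c
    unfolding g_def using M_herm[of y] that WY by (intro ip_shift_prod) auto
  have g_orth: "ip k (g y) (r j y) = 0" if "y \<in> W" "j < m" for y j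
    using g_ip[OF that(1) r_eig[OF that]] residual_orthogonal[OF r_on[OF that(1)] that(2)]
    by (simp add: u_def)
  \<comment> \<open>At the base point \<open>u\<close> has component 1 along \<open>f m\<close>, and the shifts multiply that component
    by the nonzero number $\prod_\mu(d_m-\mu)$.\<close>
  have u_f: "ip k (u y0) (f i) = (if i = m then 1 else 0)" if "m \<le> i" "i < k" for i
    using f(1) r_orth that m by (auto simp: u_def ip_residual orthonormal_def)
  have "ip k (g y0) (f m) \<noteq> 0"
    using g_ip[OF W(2) f(2)] m u_f[of m] ms by (auto simp: prod_list_zero_iff)
  moreover have "ip k (g y0) (f m) = 0" if "ip k (g y0) (g y0) = 0"
    using that unfolding ip_self_eq_0 by (simp add: ip_def)
  ultimately have "ip k (g y0) (g y0) \<noteq> 0" by blast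
  then have y0: "y0 \<in> W'" using W(2) by (simp add: W'_def ip_self del: of_real_sum of_real_power)
  have r'_cont: "continuous_map (subtopology Y W') euclidean (\<lambda>y. r' j y l)"
    if "j < Suc m" "l < k" for j l
  proof (cases "j < m")
    case True
    then show ?thesis
      using continuous_map_from_subtopology_mono[OF r_cont[OF True that(2)] W'W] by (simp add: r'_def)
  next
    case False
    have "continuous_map (subtopology Y W') euclidean (\<lambda>y. normalized k (g y) l)"
      using g_cont W'W g_nz that
      by (intro continuous_map_normalized) (auto intro: continuous_map_from_subtopology_mono)
    then show ?thesis using False by (simp add: r'_def)
  qed
  have r'_on: "orthonormal k (Suc m) (\<lambda>j. r' j y)" if "y \<in> W'" for y
    using that W'W g_orth g_nz
    by (intro orthonormal_Suc[OF r_on, of y "normalized k (g y)"])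
      (auto simp: r'_def ip_normalized intro!: ip_normalized_left[THEN trans])
  have r'_eig: "app k (M y) (r' j y) l = of_real (d j) * r' j y l"
    if yjl: "y \<in> W'" "j < Suc m" "l < k" for y j l
  proof (cases "j < m")
    case True
    then show ?thesis using r_eig that W'W by (auto simp: r'_def)
  next
    case False
    then have j: "j = m" using that by simp
    obtain U where U: "U \<in> unitary_group k" "M y = mat_adjoint U * real_diag k d * U"
      using diag[of y] yjl(1) W'W WY by blast
    have "app k (M y) (g y) l = of_real (d m) * g y l"
      unfolding g_def using ms that(3) by (intro shift_prod_eigenvector[OF U]) auto
    then show ?thesis by (simp add: r'_def j app_normalized) (simp add: normalized_def)
  qed
  have r'_orth: "ip k (r' j y0) (f i) = 0" if "j < Suc m" "Suc m \<le> i" "i < k" for i j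
  proof (cases "j < m")
    case False
    have "ip k (g y0) (f i) = 0"
      using g_ip[OF W(2) f(2)[OF that(3)]] u_f[of i] that by simp
    then show ?thesis using False by (simp add: r'_def ip_normalized_left)
  qed (use r_orth that in \<open>simp add: r'_def\<close>)
  have "partial_eigenframe Y k M d y0 f (Suc m) W' r'"
    unfolding partial_eigenframe_def using W'_open y0 r'_cont r'_on r'_eig r'_orth by blast
  then show ?thesis by blast
qed

theorem local_continuous_diagonalisation:
  fixes M :: "'y \<Rightarrow> 'e::conj_normed_field mat"
  assumes M: "continuous_map Y (mat_topology k k) M"
    and diag: "\<And>y. y \<in> topspace Y \<Longrightarrow>
        \<exists>U\<in>unitary_group k. M y = mat_adjoint U * real_diag k d * U"
    and y0: "y0 \<in> topspace Y"
  shows "\<exists>W U. openin Y W \<and> y0 \<in> W \<and> continuous_map (subtopology Y W) (mat_topology k k) U \<and>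
    (\<forall>y\<in>W. U y \<in> unitary_group k \<and> M y = mat_adjoint (U y) * real_diag k d * U y)"
proof -
  obtain U0 where U0: "U0 \<in> unitary_group k" "M y0 = mat_adjoint U0 * real_diag k d * U0"
    using diag[OF y0] by blast
  define f where "f = (\<lambda>i l. conjugate (U0 $$ (i, l)))"
  have f_on: "orthonormal k k f"
    using orthonormal_rows[OF U0(1)] unfolding orthonormal_def
    by (auto simp: f_def ip_def mult.commute)
  have f_eig: "app k (M y0) (f i) l = of_real (d i) * f i l" if "i < k" "l < k" for i l
    using app_row_conjugate[OF U0(1) that] by (simp add: f_def U0(2))
  have "\<exists>W r. partial_eigenframe Y k M d y0 f m W r" if "m \<le> k" for m
    using that
  proof (induction m)
    case 0
    show ?case using y0
      by (intro exI[of _ "topspace Y"] exI[of _ "\<lambda>_ _ _. 0"])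
        (simp add: partial_eigenframe_def orthonormal_def)
  next
    case (Suc m)
    then obtain W r where "partial_eigenframe Y k M d y0 f m W r" by auto
    with partial_eigenframe_step[OF M diag f_on f_eig] Suc.prems show ?case by auto
  qed
  from this[of k] obtain W r where r: "partial_eigenframe Y k M d y0 f k W r" by auto
  note W = partial_eigenframeD(1,2)[OF r]
  note r_cont = partial_eigenframeD(3)[OF r]
  note r_on = partial_eigenframeD(4)[OF r]
  note r_eig = partial_eigenframeD(5)[OF r]
  define U where "U = (\<lambda>y. mat k k (\<lambda>(i, l). conjugate (r i y l)))"
  have Mc: "M y \<in> carrier_mat k k" if "y \<in> W" for y
    using M openin_subset[OF W(1)] that by (auto simp: continuous_map_mat_topology_iff)
  have "continuous_map (subtopology Y W) (mat_topology k k) U"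
    unfolding continuous_map_mat_topology_iff
    using r_cont by (auto simp: U_def intro: continuous_map_conjugate)
  moreover have "U y \<in> unitary_group k \<and> M y = mat_adjoint (U y) * real_diag k d * U y"
    if "y \<in> W" for y
    unfolding U_def using eigenvector_matrix[OF Mc[OF that] r_on[OF that] r_eig[OF that]] by simp
  ultimately show ?thesis using W by blast
qed


section \<open>Matrix description of the frames and of the fiber group\<close>

lemma diag_pad_eq_real_diag:
  "diag_pad m a = real_diag m (\<lambda>i. if i < dim_vec a then a $ i else 0)"
  by (rule eq_matI) (auto simp: diag_pad_def real_diag_def)

lemma index_conjugate_real_diag:
  fixes A :: "'e::conj_normed_field mat"
  assumes A: "A \<in> carrier_mat r c" and ij: "i < c" "j < c"
  shows "(mat_adjoint A * real_diag r d * A) $$ (i, j) =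
    (\<Sum>l<r. of_real (d l) * (conjugate (A $$ (l, i)) * A $$ (l, j)))"
proof -
  have c: "mat_adjoint A * real_diag r d \<in> carrier_mat c r"
    using A by (intro mult_carrier_mat[of _ c r]) simp_all
  have "(mat_adjoint A * real_diag r d) $$ (i, l) = of_real (d l) * conjugate (A $$ (l, i))"
    if "l < r" for l
    using A ij that by (subst index_mult_sum[OF mat_adjoint_carrier[OF A] real_diag_carrier])
      (auto simp: real_diag_def if_distrib[of "\<lambda>c. _ * c"] mult.commute cong: if_cong)
  then show ?thesis
    using index_mult_sum[OF c A ij] by (simp add: mult.assoc)
qed

lemma ip_real_diag:
  "ip n (app n (real_diag n d) x) x = of_real (\<Sum>j<n. d j * (norm (x j))\<^sup>2)"
  by (simp add: ip_def app_real_diag mult.assoc mult_conjugate)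

lemma app_scalar_matrix:
  "i < n \<Longrightarrow> app n (of_real B \<cdot>\<^sub>m 1\<^sub>m n) x i = of_real B * x i"
  by (simp add: app_def if_distrib[of "\<lambda>c. c * _"] if_distrib[of "\<lambda>c. _ * c"] cong: if_cong)

text \<open>Tightness with constant \<open>B\<close> is the equation $\langle FF^*v,v\rangle=B\langle v,v\rangle$
  for all \<open>v\<close>, hence $FF^*=B\cdot I$ by polarisation.\<close>

lemma tight_frame_iff:
  fixes F :: "'e::conj_normed_field mat"
  assumes F: "F \<in> carrier_mat n k"
  shows "tight_frame n (cols F) \<longleftrightarrow> (\<exists>B>0. F * mat_adjoint F = of_real B \<cdot>\<^sub>m 1\<^sub>m n)"
proof -
  let ?H = "F * mat_adjoint F"
  have Fa: "mat_adjoint F \<in> carrier_mat k n" using F by simp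
  have H: "?H \<in> carrier_mat n n" "mat_adjoint ?H = ?H"
    using F mult_carrier_mat[OF F Fa] mat_adjoint_mult[OF F Fa] by simp_all
  have sum: "of_real (\<Sum>f\<leftarrow>cols F. (norm (v \<bullet>c f))\<^sup>2) = ip n (app n ?H (($) v)) (($) v)"
    if v: "v \<in> carrier_vec n" for v :: "'e vec"
  proof -
    have inner: "v \<bullet>c col F i = app n (mat_adjoint F) (($) v) i" if "i < k" for i
      using F v that by (simp add: scalar_prod_def app_def lessThan_atLeast0 mult.commute)
    have "(\<Sum>f\<leftarrow>cols F. (norm (v \<bullet>c f))\<^sup>2) = (\<Sum>i<k. (norm (v \<bullet>c col F i))\<^sup>2)"
      using F by (simp add: cols_def o_def interv_sum_list_conv_sum_set_nat lessThan_atLeast0)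
    also have "\<dots> = (\<Sum>i<k. (norm (app n (mat_adjoint F) (($) v) i))\<^sup>2)"
      by (simp add: inner)
    finally have "of_real (\<Sum>f\<leftarrow>cols F. (norm (v \<bullet>c f))\<^sup>2) =
        ip k (app n (mat_adjoint F) (($) v)) (app n (mat_adjoint F) (($) v))"
      by (simp add: ip_self)
    also have "\<dots> = ip n (app k F (app n (mat_adjoint F) (($) v))) (($) v)"
      using ip_app[OF F] by simp
    also have "\<dots> = ip n (app n ?H (($) v)) (($) v)"
      by (rule ip_cong) (simp_all add: app_mult[OF F Fa])
    finally show ?thesis .
  qed
  have norm: "of_real ((vec_norm v)\<^sup>2) = ip n (($) v) (($) v)" if "v \<in> carrier_vec n" for v :: "'e vec"
    using that by (simp add: vec_norm_def L2_set_def sum_nonneg ip_self)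
  have scalar: "ip n (app n (of_real B \<cdot>\<^sub>m 1\<^sub>m n) x) x = of_real B * ip n x x"
    for B and x :: "nat \<Rightarrow> 'e"
  proof -
    have "ip n (app n (of_real B \<cdot>\<^sub>m 1\<^sub>m n) x) x = ip n (\<lambda>i. of_real B * x i) x"
      by (rule ip_cong) (simp_all only: app_scalar_matrix)
    then show ?thesis by (simp add: ip_scale_left)
  qed
  have "(\<forall>v\<in>carrier_vec n. (\<Sum>f\<leftarrow>cols F. (norm (v \<bullet>c f))\<^sup>2) = B * (vec_norm v)\<^sup>2) \<longleftrightarrow>
      ?H = of_real B \<cdot>\<^sub>m 1\<^sub>m n" (is "?L \<longleftrightarrow> ?R") for B
  proof
    assume L: ?L
    show ?R
    proof (rule hermitian_eqI[OF H])
      show "mat_adjoint (of_real B \<cdot>\<^sub>m 1\<^sub>m n) = (of_real B \<cdot>\<^sub>m 1\<^sub>m n :: 'e mat)"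
        by (simp add: mat_adjoint_smult)
      fix x :: "nat \<Rightarrow> 'e"
      have v: "vec n x \<in> carrier_vec n" by simp
      have x: "app n A (($) (vec n x)) i = app n A x i" for A i
        by (rule app_cong) simp
      have "ip n (app n ?H x) x = ip n (app n ?H (($) (vec n x))) (($) (vec n x))"
        by (rule ip_cong) (simp_all add: x)
      also have "\<dots> = of_real (B * (vec_norm (vec n x))\<^sup>2)"
        using L sum[OF v] v by metis
      also have "\<dots> = of_real B * ip n x x"
        unfolding of_real_mult norm[OF v] by (simp cong: ip_cong)
      finally show "ip n (app n ?H x) x = ip n (app n (of_real B \<cdot>\<^sub>m 1\<^sub>m n) x) x"
        unfolding scalar .
    qed simp
  next
    assume R: ?R
    show ?L
    proof
      fix v :: "'e vec" assume v: "v \<in> carrier_vec n"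
      have "of_real (\<Sum>f\<leftarrow>cols F. (norm (v \<bullet>c f))\<^sup>2) = (of_real (B * (vec_norm v)\<^sup>2) :: 'e)"
        unfolding sum[OF v] R scalar of_real_mult norm[OF v] ..
      then show "(\<Sum>f\<leftarrow>cols F. (norm (v \<bullet>c f))\<^sup>2) = B * (vec_norm v)\<^sup>2"
        unfolding of_real_eq_iff .
    qed
  qed
  moreover have "set (cols F) \<subseteq> carrier_vec n" using F cols_dim[of F] by auto
  ultimately show ?thesis by (simp add: tight_frame_def)
qed

text \<open>The vector \<open>a\<close> holds the positive coefficients of the ellipsoid in dimension \<open>n\<close>, and \<open>k\<close> is the
  number of frame vectors.\<close>

locale semiaxes =
  fixes n k :: nat and a :: "real vec"
  assumes n_pos: "1 \<le> n" and n_le_k: "n \<le> k" and a_carrier: "a \<in> carrier_vec n"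
    and a_pos: "\<And>i. i < n \<Longrightarrow> 0 < a $ i"
begin

lemma dim_a [simp]: "dim_vec a = n" using a_carrier by simp

text \<open>The common frame constant of all tight frames on the ellipsoid.\<close>

definition frame_const :: real where
  "frame_const = real k / (\<Sum>j<n. a $ j)"

lemma sum_a_pos: "0 < (\<Sum>j<n. a $ j)"
  using n_pos a_pos by (intro sum_pos) (auto simp: lessThan_empty_iff)

lemma frame_const_pos: "0 < frame_const"
  using sum_a_pos n_pos n_le_k by (simp add: frame_const_def)

abbreviation D :: "'e::conj_normed_field mat" where
  "D \<equiv> real_diag n (($) a)"

lemma diag_pad_n: "diag_pad n a = D"
  unfolding diag_pad_eq_real_diag by (rule eq_matI) (auto simp: real_diag_def)

lemma gram_map_eq: "gram_map a F = mat_adjoint F * D * F"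
  by (simp add: gram_map_def diag_pad_n)

lemma gram_map_diagonal:
  fixes F :: "'e::conj_normed_field mat"
  assumes "F \<in> carrier_mat n k" "i < k"
  shows "gram_map a F $$ (i, i) = of_real (\<Sum>j<n. a $ j * (norm (F $$ (j, i)))\<^sup>2)"
  unfolding gram_map_eq using index_conjugate_real_diag[OF assms(1,2,2)]
  by (simp add: mult_conjugate mult.commute[of "conjugate _"])

lemma gram_map_carrier:
  fixes F :: "'e::conj_normed_field mat"
  shows "F \<in> carrier_mat n k \<Longrightarrow> gram_map a F \<in> carrier_mat k k"
  by (simp add: gram_map_eq)

lemma ellipsoid_iff:
  "v \<in> ellipsoid a \<longleftrightarrow> v \<in> carrier_vec n \<and> (\<Sum>j<n. a $ j * (norm (v $ j))\<^sup>2) = 1"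
  by (simp add: ellipsoid_def)

text \<open>Here the frame constant is forced by comparing the traces of $F^*DF$ and $DFF^*$.\<close>

lemma ellipsoid_frames_iff:
  fixes F :: "'e::conj_normed_field mat"
  shows "F \<in> ellipsoid_frames k a \<longleftrightarrow>
     F \<in> carrier_mat n k \<and> F * mat_adjoint F = of_real frame_const \<cdot>\<^sub>m 1\<^sub>m n \<and>
     (\<forall>i<k. gram_map a F $$ (i, i) = 1)"
proof (cases "F \<in> carrier_mat n k")
  case F: True
  have unit: "set (cols F) \<subseteq> ellipsoid a \<longleftrightarrow> (\<forall>i<k. gram_map a F $$ (i, i) = 1)"
  proof -
    have "set (cols F) = col F ` {..<k}" using F by (auto simp: cols_def)
    moreover have "col F i \<in> ellipsoid a \<longleftrightarrow> gram_map a F $$ (i, i) = 1" if "i < k" for i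
      unfolding gram_map_diagonal[OF F that] ellipsoid_iff of_real_eq_1_iff
      using F that by auto
    ultimately show ?thesis by auto
  qed
  have const: "B = frame_const"
    if B: "F * mat_adjoint F = of_real B \<cdot>\<^sub>m 1\<^sub>m n" and d: "\<forall>i<k. gram_map a F $$ (i, i) = 1" for B
  proof -
    have row: "(\<Sum>i<k. (norm (F $$ (j, i)))\<^sup>2) = B" if "j < n" for j
    proof -
      have "of_real (\<Sum>i<k. (norm (F $$ (j, i)))\<^sup>2) = (F * mat_adjoint F) $$ (j, j)"
        unfolding index_mult_adjoint[OF F F that that] ip_self ..
      also have "\<dots> = of_real B" unfolding B using that by simp
      finally show ?thesis unfolding of_real_eq_iff .
    qed
    have "(\<Sum>j<n. a $ j * (norm (F $$ (j, i)))\<^sup>2) = 1" if "i < k" for i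
      using d that gram_map_diagonal[OF F that] by (metis of_real_eq_1_iff)
    then have "real k = (\<Sum>i<k. \<Sum>j<n. a $ j * (norm (F $$ (j, i)))\<^sup>2)" by simp
    also have "\<dots> = (\<Sum>j<n. \<Sum>i<k. a $ j * (norm (F $$ (j, i)))\<^sup>2)" by (rule sum.swap)
    also have "\<dots> = (\<Sum>j<n. a $ j) * B"
      by (simp add: row sum_distrib_right flip: sum_distrib_left)
    finally show ?thesis using sum_a_pos by (simp add: frame_const_def field_simps)
  qed
  show ?thesis
    unfolding ellipsoid_frames_def using F tight_frame_iff[OF F] unit const frame_const_pos by auto
qed (simp add: ellipsoid_frames_def)

text \<open>A unitary matrix preserves the ellipsoid exactly when it preserves the Hermitian form of \<open>D\<close>,
  because every nonzero vector is a real multiple of a point of the ellipsoid.\<close>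

lemma ellipsoid_group_iff:
  fixes V :: "'e::conj_normed_field mat"
  shows "V \<in> ellipsoid_group a \<longleftrightarrow> V \<in> unitary_group n \<and> mat_adjoint V * D * V = D"
proof (cases "V \<in> unitary_group n")
  case V: True
  note V' = unitary_groupD[OF V]
  have Va: "mat_adjoint V \<in> carrier_mat n n" using V' by simp
  define q where "q = (\<lambda>x :: nat \<Rightarrow> 'e. \<Sum>j<n. a $ j * (norm (x j))\<^sup>2)"
  have mem: "v \<in> ellipsoid a \<longleftrightarrow> v \<in> carrier_vec n \<and> q (($) v) = 1" for v
    by (simp add: ellipsoid_iff q_def)
  have q_cong: "q x = q y" if "\<And>j. j < n \<Longrightarrow> x j = y j" for x y
    unfolding q_def using that by (intro sum.cong) auto
  have mult: "(A *\<^sub>v v) $ j = app n A (($) v) j" 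
    if "A \<in> carrier_mat n n" "v \<in> carrier_vec n" "j < n" for A :: "'e mat" and v j
    using that by (simp add: scalar_prod_def app_def lessThan_atLeast0)
  have form: "ip n (app n (mat_adjoint A * D * A) x) x = of_real (q (app n A x))"
    if A: "A \<in> carrier_mat n n" for A :: "'e mat" and x
  proof -
    have AD: "mat_adjoint A * D \<in> carrier_mat n n"
      using A by (intro mult_carrier_mat[of _ n n]) simp_all
    have "ip n (app n (mat_adjoint A * D * A) x) x =
        ip n (app n (mat_adjoint A) (app n D (app n A x))) x"
      using A by (intro ip_cong)
        (simp_all add: app_mult[OF AD A] app_mult[OF mat_adjoint_carrier[OF A] real_diag_carrier])
    also have "\<dots> = ip n (app n D (app n A x)) (app n A x)"
      using ip_app[OF mat_adjoint_carrier[OF A]] by simp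
    finally show ?thesis by (simp add: ip_real_diag q_def)
  qed
  have "(\<lambda>v. V *\<^sub>v v) ` ellipsoid a = ellipsoid a \<longleftrightarrow> mat_adjoint V * D * V = D" (is "?L \<longleftrightarrow> ?R")
  proof
    assume L: ?L
    have same: "q (app n V x) = q x" for x
    proof (cases "q x = 0")
      case True
      then have "x j = 0" if "j < n" for j
        using that a_pos by (subst (asm) q_def, subst (asm) sum_nonneg_eq_0_iff) force+
      then have "app n V x j = 0" for j by (simp add: app_def)
      then show ?thesis using True by (simp add: q_def)
    next
      case False
      moreover have "0 \<le> q x"
        unfolding q_def using a_pos by (intro sum_nonneg mult_nonneg_nonneg) (auto intro: less_imp_le)
      ultimately have pos: "0 < q x" by simp
      define t where "t = inverse (sqrt (q x))"
      have t: "t\<^sup>2 * q x = 1" using pos by (simp add: t_def power_inverse)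
      have scale: "q (\<lambda>j. of_real t * y j) = t\<^sup>2 * q y" for y
        by (simp add: q_def norm_mult power_mult_distrib sum_distrib_left mult_ac)
      define v where "v = vec n (\<lambda>j. of_real t * x j)"
      have vc: "v \<in> carrier_vec n" by (simp add: v_def)
      have "q (($) v) = q (\<lambda>j. of_real t * x j)" by (rule q_cong) (simp add: v_def)
      then have "v \<in> ellipsoid a" using vc t by (simp add: mem scale)
      then have "V *\<^sub>v v \<in> ellipsoid a" using L by blast
      then have "q (($) (V *\<^sub>v v)) = 1" by (simp add: mem)
      moreover have "q (($) (V *\<^sub>v v)) = q (\<lambda>j. of_real t * app n V x j)"
      proof (rule q_cong)
        fix j assume j: "j < n"
        have "(V *\<^sub>v v) $ j = app n V (($) v) j" by (rule mult[OF V'(1) vc j])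
        also have "\<dots> = app n V (\<lambda>j. of_real t * x j) j" by (rule app_cong) (simp add: v_def)
        finally show "(V *\<^sub>v v) $ j = of_real t * app n V x j" by (simp add: app_scale)
      qed
      ultimately have "t\<^sup>2 * q (app n V x) = t\<^sup>2 * q x" using t by (simp add: scale)
      moreover have "t\<^sup>2 \<noteq> 0" using t by auto
      ultimately show ?thesis by simp
    qed
    have VDV: "mat_adjoint (mat_adjoint V * D * V) = mat_adjoint V * D * V"
      by (rule unitary_conjugate_hermitian[OF V])
    show ?R
    proof (rule hermitian_eqI[OF _ VDV real_diag_carrier mat_adjoint_real_diag])
      show "mat_adjoint V * D * V \<in> carrier_mat n n" using V' by simp
      show "ip n (app n (mat_adjoint V * D * V) x) x = ip n (app n D x) x" for x
        unfolding form[OF V'(1)] same by (simp add: ip_real_diag q_def)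
    qed
  next
    assume R: ?R
    have q_V: "q (app n V x) = q x" for x
    proof -
      have "of_real (q (app n V x)) = (of_real (q x) :: 'e)"
        unfolding form[OF V'(1), symmetric] R by (simp add: ip_real_diag q_def)
      then show ?thesis unfolding of_real_eq_iff .
    qed
    have in_V: "V *\<^sub>v v \<in> ellipsoid a \<longleftrightarrow> v \<in> ellipsoid a" if v: "v \<in> carrier_vec n" for v
    proof -
      have "q (($) (V *\<^sub>v v)) = q (app n V (($) v))"
        by (rule q_cong) (rule mult[OF V'(1) v])
      then show ?thesis using V' v q_V by (simp add: mem)
    qed
    show ?L
    proof
      show "(\<lambda>v. V *\<^sub>v v) ` ellipsoid a \<subseteq> ellipsoid a" using in_V by (auto simp: mem)
      show "ellipsoid a \<subseteq> (\<lambda>v. V *\<^sub>v v) ` ellipsoid a"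
      proof
        fix w :: "'e vec" assume w: "w \<in> ellipsoid a"
        then have wc: "w \<in> carrier_vec n" by (simp add: mem)
        define v where "v = mat_adjoint V *\<^sub>v w"
        have vc: "v \<in> carrier_vec n" using Va wc by (simp add: v_def)
        have "V *\<^sub>v v = (V * mat_adjoint V) *\<^sub>v w"
          using assoc_mult_mat_vec[OF V'(1) Va wc] by (simp add: v_def)
        then have "V *\<^sub>v v = w" using V' wc by simp
        then show "w \<in> (\<lambda>v. V *\<^sub>v v) ` ellipsoid a" using in_V[OF vc] w by force
      qed
    qed
  qed
  then show ?thesis using V by (simp add: ellipsoid_group_def)
qed (simp add: ellipsoid_group_def)

end


section \<open>The fibers of the Gram map\<close>

lemma smult_smult_mat: "x \<cdot>\<^sub>m (y \<cdot>\<^sub>m A) = (x * y) \<cdot>\<^sub>m (A :: 'e::semigroup_mult mat)"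
  by (rule eq_matI) (auto simp: mult.assoc)

lemma smult_one_mat: "1 \<cdot>\<^sub>m A = (A :: 'e::monoid_mult mat)"
  by (rule eq_matI) auto

lemma smult_mat_cancel:
  fixes A B :: "'e::field mat"
  assumes "c \<noteq> 0" "c \<cdot>\<^sub>m A = c \<cdot>\<^sub>m B"
  shows "A = B"
  using arg_cong[OF assms(2), of "\<lambda>X. inverse c \<cdot>\<^sub>m X"] assms(1)
  by (simp add: smult_smult_mat smult_one_mat)

lemma real_diag_mult_cancel:
  fixes A B :: "'e::conj_normed_field mat"
  assumes AB: "A \<in> carrier_mat r c" "B \<in> carrier_mat r c" and d: "\<And>i. i < r \<Longrightarrow> d i \<noteq> 0"
    and eq: "real_diag r d * A = real_diag r d * B"
  shows "A = B"
proof (rule eq_matI)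
  have ind: "(real_diag r d * X) $$ (i, j) = of_real (d i) * X $$ (i, j)"
    if "X \<in> carrier_mat r c" "i < r" "j < c" for X :: "'e mat" and i j
    using index_mult_sum[OF real_diag_carrier that]
    by (simp add: real_diag_def that if_distrib[of "\<lambda>c. c * _"] cong: if_cong)
  fix i j assume "i < dim_row B" "j < dim_col B"
  then have ij: "i < r" "j < c" using AB by auto
  then show "A $$ (i, j) = B $$ (i, j)"
    using arg_cong[OF eq, of "\<lambda>X. X $$ (i, j)"] d by (simp add: ind AB)
qed (use AB in auto)

context semiaxes
begin

text \<open>For frames \<open>F\<close> and \<open>G\<close> the matrix \<open>V\<close> with \<open>F = V G\<close>, if there is one, is determined by
  $FG^*=VGG^*=\beta V$.\<close>

definition transition :: "'e mat \<Rightarrow> 'e mat \<Rightarrow> 'e::conj_normed_field mat" where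
  "transition F G = of_real (inverse frame_const) \<cdot>\<^sub>m (F * mat_adjoint G)"

lemma ellipsoid_framesD:
  fixes F :: "'e::conj_normed_field mat"
  assumes "F \<in> ellipsoid_frames k a"
  shows "F \<in> carrier_mat n k" "F * mat_adjoint F = of_real frame_const \<cdot>\<^sub>m 1\<^sub>m n"
  using assms by (simp_all add: ellipsoid_frames_iff)

lemma transition_mult:
  fixes G :: "'e::conj_normed_field mat"
  assumes V: "V \<in> carrier_mat n n" and G: "G \<in> ellipsoid_frames k a"
  shows "transition (V * G) G = V"
proof -
  note G' = ellipsoid_framesD[OF G]
  have "V * G * mat_adjoint G = V * (of_real frame_const \<cdot>\<^sub>m 1\<^sub>m n)"
    using assoc_mult_mat[OF V G'(1) mat_adjoint_carrier[OF G'(1)]] G'(2) by simp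
  also have "\<dots> = of_real frame_const \<cdot>\<^sub>m V"
    using mult_smult_distrib[OF V one_carrier_mat] V by simp
  finally show ?thesis
    using frame_const_pos by (simp add: transition_def smult_smult_mat smult_one_mat)
qed

lemma group_acts_on_fibers:
  fixes V G :: "'e::conj_normed_field mat"
  assumes V: "V \<in> ellipsoid_group a" and G: "G \<in> ellipsoid_frames k a"
  shows "V * G \<in> ellipsoid_frames k a" "gram_map a (V * G) = gram_map a G"
proof -
  have VU: "V \<in> unitary_group n" and VD: "mat_adjoint V * D * V = D"
    using V by (auto simp: ellipsoid_group_iff)
  note V' = unitary_groupD[OF VU]
  note G' = ellipsoid_framesD[OF G]
  have Va: "mat_adjoint V \<in> carrier_mat n n" and Ga: "mat_adjoint G \<in> carrier_mat k n"
    and VG: "V * G \<in> carrier_mat n k" and DVG: "D * (V * G) \<in> carrier_mat n k"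
    and DV: "D * V \<in> carrier_mat n n"
    using V' G' by (auto intro!: mult_carrier_mat)
  have adj: "mat_adjoint (V * G) = mat_adjoint G * mat_adjoint V"
    by (rule mat_adjoint_mult[OF V'(1) G'(1)])
  have "gram_map a (V * G) = mat_adjoint G * (mat_adjoint V * (D * (V * G)))"
    unfolding gram_map_eq adj
    using assoc_mult_mat[OF mult_carrier_mat[OF Ga Va] real_diag_carrier VG]
      assoc_mult_mat[OF Ga Va DVG] by simp
  also have "mat_adjoint V * (D * (V * G)) = D * G"
    using VD assoc_mult_mat[OF real_diag_carrier V'(1) G'(1)] assoc_mult_mat[OF Va DV G'(1)]
      assoc_mult_mat[OF Va real_diag_carrier V'(1)] by simp
  also have "mat_adjoint G * (D * G) = gram_map a G"
    unfolding gram_map_eq using assoc_mult_mat[OF Ga real_diag_carrier G'(1)] by simp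
  finally show gram: "gram_map a (V * G) = gram_map a G" .
  have "V * G * mat_adjoint (V * G) = V * (G * mat_adjoint G) * mat_adjoint V"
    unfolding adj using assoc_mult_mat[OF VG Ga Va] assoc_mult_mat[OF V'(1) G'(1) Ga] by simp
  also have "\<dots> = of_real frame_const \<cdot>\<^sub>m (V * mat_adjoint V)"
    unfolding G'(2) using V' mult_smult_distrib[OF V'(1) one_carrier_mat] mult_smult_assoc_mat[OF V'(1) Va]
    by simp
  finally have "V * G * mat_adjoint (V * G) = of_real frame_const \<cdot>\<^sub>m 1\<^sub>m n" using V' by simp
  then show "V * G \<in> ellipsoid_frames k a"
    using G VG gram by (simp add: ellipsoid_frames_iff)
qed

text \<open>Write $V$ for the transition matrix. Multiplying $F^*DF=G^*DG$ by $F$ on the left gives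
  $DF=VDG$; multiplying this by $G^*$ on the right gives $DV=VD$. Hence $DF=DVG$ and $F=VG$.\<close>

lemma transition_of_equal_gram:
  fixes F G :: "'e::conj_normed_field mat"
  assumes F: "F \<in> ellipsoid_frames k a" and G: "G \<in> ellipsoid_frames k a"
    and eq: "gram_map a F = gram_map a G"
  shows "transition F G \<in> ellipsoid_group a" "transition F G * G = F"
proof -
  note F' = ellipsoid_framesD[OF F]
  note G' = ellipsoid_framesD[OF G]
  define \<beta> where "\<beta> = (of_real frame_const :: 'e)"
  define V where "V = transition F G"
  have \<beta>: "\<beta> \<noteq> 0" using frame_const_pos by (simp add: \<beta>_def)
  have Fa: "mat_adjoint F \<in> carrier_mat k n" and Ga: "mat_adjoint G \<in> carrier_mat k n"
    and FGa: "F * mat_adjoint G \<in> carrier_mat n n"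
    and DF: "D * F \<in> carrier_mat n k" and DG: "D * G \<in> carrier_mat n k"
    using F' G' by (auto intro!: mult_carrier_mat)
  have V: "V \<in> carrier_mat n n" using FGa by (simp add: V_def transition_def)
  have Va: "mat_adjoint V \<in> carrier_mat n n" using V by simp
  have FG: "F * mat_adjoint G = \<beta> \<cdot>\<^sub>m V"
    using \<beta> by (simp add: V_def transition_def \<beta>_def smult_smult_mat smult_one_mat)
  have "\<beta> \<cdot>\<^sub>m (D * F) = F * mat_adjoint F * (D * F)"
    unfolding F'(2) \<beta>_def mult_smult_assoc_mat[OF one_carrier_mat DF] left_mult_one_mat[OF DF] ..
  also have "\<dots> = F * gram_map a F"
    unfolding gram_map_eq using assoc_mult_mat[OF F'(1) Fa DF] assoc_mult_mat[OF Fa real_diag_carrier F'(1)]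
    by simp
  also have "\<dots> = F * mat_adjoint G * (D * G)"
    unfolding eq unfolding gram_map_eq using assoc_mult_mat[OF F'(1) Ga DG]
      assoc_mult_mat[OF Ga real_diag_carrier G'(1)] by simp
  also have "\<dots> = \<beta> \<cdot>\<^sub>m (V * (D * G))"
    unfolding FG by (rule mult_smult_assoc_mat[OF V DG])
  finally have DF_eq: "D * F = V * (D * G)" by (rule smult_mat_cancel[OF \<beta>])
  have "\<beta> \<cdot>\<^sub>m (D * V) = D * (F * mat_adjoint G)"
    unfolding FG by (rule mult_smult_distrib[OF real_diag_carrier V, symmetric])
  also have "\<dots> = V * (D * G) * mat_adjoint G"
    unfolding DF_eq[symmetric] using assoc_mult_mat[OF real_diag_carrier F'(1) Ga] by simp
  also have "\<dots> = V * (D * (G * mat_adjoint G))"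
    using assoc_mult_mat[OF V DG Ga] assoc_mult_mat[OF real_diag_carrier G'(1) Ga] by simp
  also have "\<dots> = V * (\<beta> \<cdot>\<^sub>m D)"
    unfolding G'(2) \<beta>_def using mult_smult_distrib[OF real_diag_carrier one_carrier_mat]
      right_mult_one_mat[OF real_diag_carrier] by metis
  also have "\<dots> = \<beta> \<cdot>\<^sub>m (V * D)"
    by (rule mult_smult_distrib[OF V real_diag_carrier])
  finally have comm: "D * V = V * D" by (rule smult_mat_cancel[OF \<beta>])
  have "D * F = D * (V * G)"
    unfolding DF_eq using comm assoc_mult_mat[OF V real_diag_carrier G'(1)]
      assoc_mult_mat[OF real_diag_carrier V G'(1)] by metis
  then have F_eq: "F = V * G"
    using a_pos mult_carrier_mat[OF V G'(1)]
    by (intro real_diag_mult_cancel[OF F'(1), where d="($) a"]) (auto simp: less_imp_neq[symmetric])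
  then show "transition F G * G = F" by (simp add: V_def)
  have "\<beta> \<cdot>\<^sub>m 1\<^sub>m n = V * G * mat_adjoint (V * G)"
    using F'(2) F_eq by (simp add: \<beta>_def)
  also have "\<dots> = V * (G * mat_adjoint G) * mat_adjoint V"
    unfolding mat_adjoint_mult[OF V G'(1)]
    using assoc_mult_mat[OF mult_carrier_mat[OF V G'(1)] Ga Va] assoc_mult_mat[OF V G'(1) Ga] by simp
  also have "\<dots> = \<beta> \<cdot>\<^sub>m (V * mat_adjoint V)"
    unfolding G'(2) \<beta>_def[symmetric]
    using V mult_smult_distrib[OF V one_carrier_mat] mult_smult_assoc_mat[OF V Va] by simp
  finally have "V * mat_adjoint V = 1\<^sub>m n" by (rule smult_mat_cancel[OF \<beta>, symmetric])
  then have VU: "V \<in> unitary_group n" by (rule unitary_groupI[OF V])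
  have "mat_adjoint V * D * V = mat_adjoint V * V * D"
    using comm assoc_mult_mat[OF Va real_diag_carrier V] assoc_mult_mat[OF Va V real_diag_carrier]
    by simp
  then have "mat_adjoint V * D * V = D"
    using unitary_groupD[OF VU] left_mult_one_mat[OF real_diag_carrier] by simp
  then show "transition F G \<in> ellipsoid_group a"
    using VU by (simp add: ellipsoid_group_iff V_def)
qed


section \<open>Frames from unitary matrices\<close>

text \<open>The first \<open>n\<close> rows of a unitary matrix, scaled to the frame constant.\<close>

definition top_frame :: "'e mat \<Rightarrow> 'e::conj_normed_field mat" where
  "top_frame U = mat n k (\<lambda>(i, j). of_real (sqrt frame_const) * U $$ (i, j))"

lemma top_frame_carrier [simp]: "top_frame U \<in> carrier_mat n k"
  by (simp add: top_frame_def)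

lemma top_frame_mult_adjoint:
  fixes U :: "'e::conj_normed_field mat"
  assumes U: "U \<in> unitary_group k"
  shows "top_frame U * mat_adjoint (top_frame U) = of_real frame_const \<cdot>\<^sub>m 1\<^sub>m n"
proof (rule eq_matI)
  fix i j assume "i < dim_row (of_real frame_const \<cdot>\<^sub>m 1\<^sub>m n :: 'e mat)"
    "j < dim_col (of_real frame_const \<cdot>\<^sub>m 1\<^sub>m n :: 'e mat)"
  then have ij: "i < n" "j < n" by auto
  let ?s = "of_real (sqrt frame_const) :: 'e"
  have "(top_frame U * mat_adjoint (top_frame U)) $$ (i, j) =
      ip k (\<lambda>l. top_frame U $$ (i, l)) (\<lambda>l. top_frame U $$ (j, l))"
    by (rule index_mult_adjoint[OF top_frame_carrier top_frame_carrier ij])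
  also have "\<dots> = ip k (\<lambda>l. ?s * U $$ (i, l)) (\<lambda>l. ?s * U $$ (j, l))"
    using ij by (intro ip_cong) (simp_all add: top_frame_def)
  also have "\<dots> = ?s * ?s * ip k (\<lambda>l. U $$ (i, l)) (\<lambda>l. U $$ (j, l))"
    by (simp add: ip_scale_left ip_scale_right mult.assoc)
  also have "?s * ?s = of_real frame_const"
    using frame_const_pos by (simp flip: of_real_mult)
  finally show "(top_frame U * mat_adjoint (top_frame U)) $$ (i, j) =
      (of_real frame_const \<cdot>\<^sub>m 1\<^sub>m n) $$ (i, j)"
    using orthonormal_rows[OF U] ij n_le_k by (simp add: orthonormal_def)
qed (auto simp: top_frame_def)

lemma gram_top_frame:
  fixes U :: "'e::conj_normed_field mat"
  assumes U: "U \<in> carrier_mat k k"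
  shows "gram_map a (top_frame U) = of_real frame_const \<cdot>\<^sub>m (mat_adjoint U * diag_pad k a * U)"
proof (rule eq_matI)
  fix i j
  assume "i < dim_row (of_real frame_const \<cdot>\<^sub>m (mat_adjoint U * diag_pad k a * U))"
    "j < dim_col (of_real frame_const \<cdot>\<^sub>m (mat_adjoint U * diag_pad k a * U))"
  then have ij: "i < k" "j < k" using U by auto
  let ?s = "of_real (sqrt frame_const) :: 'e"
  have s: "?s * (?s * x) = of_real frame_const * x" for x
    using frame_const_pos by (simp flip: of_real_mult mult.assoc)
  have "gram_map a (top_frame U) $$ (i, j) =
      (\<Sum>l<n. of_real (a $ l) * (conjugate (top_frame U $$ (l, i)) * top_frame U $$ (l, j)))"
    unfolding gram_map_eq by (rule index_conjugate_real_diag[OF top_frame_carrier ij])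
  also have "\<dots> = (\<Sum>l<n. ?s * (?s * (of_real (a $ l) * (conjugate (U $$ (l, i)) * U $$ (l, j)))))"
    using ij by (intro sum.cong) (auto simp: top_frame_def conjugate_dist_mul mult_ac)
  also have "\<dots> = of_real frame_const * (\<Sum>l<n. of_real (a $ l) * (conjugate (U $$ (l, i)) * U $$ (l, j)))"
    unfolding s sum_distrib_left ..
  also have "(\<Sum>l<n. of_real (a $ l) * (conjugate (U $$ (l, i)) * U $$ (l, j))) =
      (\<Sum>l<k. of_real (if l < n then a $ l else 0) * (conjugate (U $$ (l, i)) * U $$ (l, j)))"
    using n_le_k by (intro sum.mono_neutral_cong_left) auto
  also have "\<dots> = (mat_adjoint U * diag_pad k a * U) $$ (i, j)"
    unfolding diag_pad_eq_real_diag using index_conjugate_real_diag[OF U ij] by simp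
  finally show "gram_map a (top_frame U) $$ (i, j) =
      (of_real frame_const \<cdot>\<^sub>m (mat_adjoint U * diag_pad k a * U)) $$ (i, j)"
    using U ij by simp
qed (use U in \<open>auto simp: gram_map_eq top_frame_def\<close>)

lemma gram_matrices_iff:
  fixes R :: "'e::conj_normed_field mat"
  shows "R \<in> gram_matrices k a \<longleftrightarrow>
     (\<exists>U\<in>unitary_group k. R = gram_map a (top_frame U)) \<and> (\<forall>i<k. R $$ (i, i) = 1)"
  unfolding gram_matrices_def
  by (auto simp: gram_top_frame unitary_groupD(1) frame_const_def)

lemma top_frame_in_ellipsoid_frames:
  assumes "U \<in> unitary_group k" "gram_map a (top_frame U) \<in> gram_matrices k a"
  shows "top_frame U \<in> ellipsoid_frames k a"
  using assms by (simp add: ellipsoid_frames_iff top_frame_mult_adjoint gram_matrices_iff)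

text \<open>The rows of $\beta^{-1/2}F$ are orthonormal. Completing them to the rows of a unitary matrix \<open>U\<close> makes
  \<open>F\<close> the top frame of \<open>U\<close>.\<close>

lemma gram_map_in_gram_matrices:
  fixes F :: "'e::conj_normed_field mat"
  assumes F: "F \<in> ellipsoid_frames k a"
  shows "gram_map a F \<in> gram_matrices k a"
proof -
  note F' = ellipsoid_framesD[OF F]
  define c where "c = inverse (sqrt frame_const)"
  have c: "c * (c * frame_const) = 1" "sqrt frame_const * c = 1"
    using frame_const_pos by (simp_all add: c_def field_simps)
  define r where "r = (\<lambda>i l. of_real c * F $$ (i, l))"
  have "orthonormal k n r"
    unfolding orthonormal_def
  proof (intro allI impI)
    fix i j assume ij: "i < n" "j < n"
    have "ip k (r i) (r j) = of_real c * (of_real c * (F * mat_adjoint F) $$ (i, j))"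
      unfolding r_def index_mult_adjoint[OF F'(1) F'(1) ij] by (simp add: ip_scale_left ip_scale_right)
    also have "\<dots> = of_real (c * (c * frame_const)) * (if i = j then 1 else 0)"
      unfolding F'(2) using ij by simp
    finally show "ip k (r i) (r j) = (if i = j then 1 else 0)" unfolding c by simp
  qed
  from orthonormal_completion[OF this n_le_k]
  obtain r' where r': "orthonormal k k r'" "\<forall>i<n. r' i = r i" by blast
  define U where "U = mat k k (\<lambda>(i, l). r' i l)"
  have Uc: "U \<in> carrier_mat k k" by (simp add: U_def)
  have "U * mat_adjoint U = 1\<^sub>m k"
  proof (rule eq_matI)
    fix i j assume "i < dim_row (1\<^sub>m k :: 'e mat)" "j < dim_col (1\<^sub>m k :: 'e mat)"
    then have ij: "i < k" "j < k" by auto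
    have "(U * mat_adjoint U) $$ (i, j) = ip k (\<lambda>l. U $$ (i, l)) (\<lambda>l. U $$ (j, l))"
      by (rule index_mult_adjoint[OF Uc Uc ij])
    also have "\<dots> = ip k (r' i) (r' j)"
      using ij by (intro ip_cong) (simp_all add: U_def)
    finally show "(U * mat_adjoint U) $$ (i, j) = 1\<^sub>m k $$ (i, j)"
      using r'(1) ij by (simp add: orthonormal_def)
  qed (use Uc in auto)
  then have U: "U \<in> unitary_group k" by (rule unitary_groupI[OF Uc])
  have "top_frame U = F"
  proof (rule eq_matI)
    fix i j assume "i < dim_row F" "j < dim_col F"
    then have ij: "i < n" "j < k" using F' by auto
    then have "top_frame U $$ (i, j) = of_real (sqrt frame_const * c) * F $$ (i, j)"
      using r'(2) n_le_k by (simp add: top_frame_def U_def r_def)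
    then show "top_frame U $$ (i, j) = F $$ (i, j)" unfolding c by simp
  qed (use F' in \<open>auto simp: top_frame_def\<close>)
  then show ?thesis
    using U F by (auto simp: gram_matrices_iff ellipsoid_frames_iff)
qed


section \<open>Local trivialisations\<close>

lemma topspace_frame_space: "topspace (frame_space k a) = (ellipsoid_frames k a :: 'e::conj_normed_field mat set)"
  by (auto simp: frame_space_def ellipsoid_frames_def)

lemma topspace_gram_space: "topspace (gram_space k a) = (gram_matrices k a :: 'e::conj_normed_field mat set)"
  by (auto simp: gram_space_def gram_matrices_iff intro!: gram_map_carrier)

lemma topspace_ellipsoid_group_space:
  "topspace (ellipsoid_group_space a) = (ellipsoid_group a :: 'e::conj_normed_field mat set)"
  by (auto simp: ellipsoid_group_space_def ellipsoid_group_def unitary_group_def)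

lemma continuous_map_gram_map:
  "continuous_map (frame_space k a) (gram_space k a) (gram_map a :: 'e::conj_normed_field mat \<Rightarrow> _)"
proof -
  have id: "continuous_map (frame_space k a) (mat_topology n k) (\<lambda>F. F :: 'e mat)"
    unfolding frame_space_def dim_a by (rule continuous_map_from_subtopology) simp
  have "continuous_map (frame_space k a) (mat_topology k k) (\<lambda>F. mat_adjoint F * D * F :: 'e mat)"
    by (intro continuous_map_mat_mult[where m=n] continuous_map_mat_adjoint continuous_map_mat_const id)
      simp
  then show ?thesis
    unfolding gram_space_def continuous_map_in_subtopology
    using gram_map_in_gram_matrices by (auto simp: gram_map_eq[abs_def] topspace_frame_space)
qed

lemma local_section:
  fixes R0 :: "'e::conj_normed_field mat"
  assumes "R0 \<in> gram_matrices k a"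
  shows "\<exists>W s. openin (gram_space k a) W \<and> R0 \<in> W \<and>
    continuous_map (subtopology (gram_space k a) W) (mat_topology n k) s \<and>
    (\<forall>R\<in>W. s R \<in> ellipsoid_frames k a \<and> gram_map a (s R) = R)"
proof -
  let ?Y = "gram_space k a :: 'e mat topology"
  define d where "d = (\<lambda>i. frame_const * (if i < n then a $ i else 0))"
  have conj: "mat_adjoint U * real_diag k d * U = gram_map a (top_frame U)"
    if "U \<in> unitary_group k" for U :: "'e mat"
  proof -
    note Uc = unitary_groupD(1)[OF that]
    show ?thesis unfolding gram_top_frame[OF Uc] diag_pad_eq_real_diag
    proof (rule eq_matI)
      fix i j
      assume "i < dim_row (of_real frame_const \<cdot>\<^sub>m
            (mat_adjoint U * real_diag k (\<lambda>i. if i < dim_vec a then a $ i else 0) * U))"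
        "j < dim_col (of_real frame_const \<cdot>\<^sub>m
            (mat_adjoint U * real_diag k (\<lambda>i. if i < dim_vec a then a $ i else 0) * U))"
      then have ij: "i < k" "j < k" using Uc by auto
      show "(mat_adjoint U * real_diag k d * U) $$ (i, j) = (of_real frame_const \<cdot>\<^sub>m
            (mat_adjoint U * real_diag k (\<lambda>i. if i < dim_vec a then a $ i else 0) * U)) $$ (i, j)"
        using ij Uc index_conjugate_real_diag[OF Uc ij]
        by (simp add: d_def sum_distrib_left mult.assoc del: index_mult_mat(1))
    qed (use Uc in auto)
  qed
  have id: "continuous_map ?Y (mat_topology k k) (\<lambda>R. R)"
    unfolding gram_space_def by (rule continuous_map_from_subtopology) simp
  have diag: "\<exists>U\<in>unitary_group k. R = mat_adjoint U * real_diag k d * U" if "R \<in> topspace ?Y" for R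
    using that conj by (metis gram_matrices_iff topspace_gram_space)
  have R0: "R0 \<in> topspace ?Y" using assms by (simp add: topspace_gram_space)
  obtain W U where W: "openin ?Y W" "R0 \<in> W"
    and U_cont: "continuous_map (subtopology ?Y W) (mat_topology k k) U"
    and U: "\<And>R. R \<in> W \<Longrightarrow> U R \<in> unitary_group k"
      "\<And>R. R \<in> W \<Longrightarrow> R = mat_adjoint (U R) * real_diag k d * U R"
    using local_continuous_diagonalisation[OF id diag R0] by blast
  have W_gram: "W \<subseteq> gram_matrices k a" using openin_subset[OF W(1)] by (simp add: topspace_gram_space)
  have "continuous_map (subtopology ?Y W) (mat_topology n k) (\<lambda>R. top_frame (U R))"
    unfolding continuous_map_mat_topology_iff
    using U_cont n_le_k
    by (auto simp: top_frame_def continuous_map_mat_topology_iff intro!: continuous_map_mult)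
  moreover have "gram_map a (top_frame (U R)) = R" if "R \<in> W" for R
    using conj[OF U(1)[OF that]] U(2)[OF that] by simp
  moreover from this have "top_frame (U R) \<in> ellipsoid_frames k a" if "R \<in> W" for R
    using W_gram that U(1) by (intro top_frame_in_ellipsoid_frames) auto
  ultimately show ?thesis using W by blast
qed

theorem gram_map_bundle:
  "locally_trivial_bundle (frame_space k a :: 'e::conj_normed_field mat topology)
     (gram_space k a) (gram_map a) (ellipsoid_group_space a :: 'e mat topology)"
  unfolding locally_trivial_bundle_def
proof (intro conjI ballI continuous_map_gram_map)
  let ?X = "frame_space k a :: 'e mat topology" and ?Y = "gram_space k a :: 'e mat topology"
    and ?T = "ellipsoid_group_space a :: 'e mat topology"
  fix R0 assume "R0 \<in> topspace ?Y"
  then obtain W s where W: "openin ?Y W" "R0 \<in> W"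
    and s_cont: "continuous_map (subtopology ?Y W) (mat_topology n k) s"
    and s: "\<And>R. R \<in> W \<Longrightarrow> s R \<in> ellipsoid_frames k a" "\<And>R. R \<in> W \<Longrightarrow> gram_map a (s R) = R"
    using local_section[of R0] unfolding topspace_gram_space by blast
  have WY: "W \<subseteq> gram_matrices k a" using openin_subset[OF W(1)] by (simp add: topspace_gram_space)
  define XW where "XW = subtopology ?X {F \<in> topspace ?X. gram_map a F \<in> W}"
  define P where "P = prod_topology (subtopology ?Y W) ?T"
  define \<phi> where "\<phi> = (\<lambda>F. (gram_map a F, transition F (s (gram_map a F))))"
  define \<psi> where "\<psi> = (\<lambda>(R, V). V * s R)"
  have XW: "F \<in> topspace XW \<longleftrightarrow> F \<in> ellipsoid_frames k a \<and> gram_map a F \<in> W" for F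
    by (auto simp: XW_def topspace_frame_space)
  have P: "p \<in> topspace P \<longleftrightarrow> fst p \<in> W \<and> snd p \<in> ellipsoid_group a" for p
    using WY by (cases p) (auto simp: P_def topspace_gram_space topspace_ellipsoid_group_space)
  have \<phi>_fst: "continuous_map XW (subtopology ?Y W) (gram_map a)"
    unfolding continuous_map_in_subtopology XW_def
    using continuous_map_gram_map by (auto intro: continuous_map_from_subtopology)
  have idX: "continuous_map XW (mat_topology n k) (\<lambda>F. F)"
    unfolding XW_def frame_space_def dim_a by (intro continuous_map_from_subtopology) simp
  have s_gram: "continuous_map XW (mat_topology n k) (\<lambda>F. s (gram_map a F))"
    using continuous_map_compose[OF \<phi>_fst s_cont] by (simp add: o_def)
  have "continuous_map XW (mat_topology n n) (\<lambda>F. transition F (s (gram_map a F)))"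
    unfolding transition_def
    by (intro continuous_map_mat_smult continuous_map_mat_mult[where m=k] continuous_map_mat_adjoint
        idX s_gram)
  moreover have "transition F (s (gram_map a F)) \<in> ellipsoid_group a" if "F \<in> topspace XW" for F
    using that s by (intro transition_of_equal_gram(1)) (simp_all add: XW)
  ultimately have \<phi>_snd: "continuous_map XW ?T (\<lambda>F. transition F (s (gram_map a F)))"
    unfolding ellipsoid_group_space_def dim_a continuous_map_in_subtopology
    by blast
  have fst: "continuous_map P (subtopology ?Y W) fst" and snd: "continuous_map P ?T snd"
    unfolding P_def by (rule continuous_map_fst continuous_map_snd)+
  have snd': "continuous_map P (mat_topology n n) snd"
    using snd unfolding ellipsoid_group_space_def dim_a continuous_map_in_subtopology by blast
  have s_fst: "continuous_map P (mat_topology n k) (\<lambda>p. s (fst p))"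
    using continuous_map_compose[OF fst s_cont] by (simp add: o_def)
  have "continuous_map P (mat_topology n k) (\<lambda>p. snd p * s (fst p))"
    by (rule continuous_map_mat_mult[OF snd' s_fst])
  moreover have acts: "V * s R \<in> ellipsoid_frames k a" "gram_map a (V * s R) = R"
    if "R \<in> W" "V \<in> ellipsoid_group a" for R V
    using group_acts_on_fibers[OF that(2) s(1)[OF that(1)]] s(2)[OF that(1)] by simp_all
  ultimately have \<psi>_cont: "continuous_map P XW \<psi>"
    unfolding XW_def frame_space_def dim_a continuous_map_in_subtopology \<psi>_def
    by (auto simp: P case_prod_unfold ellipsoid_frames_iff[THEN iffD1, THEN conjunct1])
  have "homeomorphic_maps XW P \<phi> \<psi>"
    unfolding homeomorphic_maps_def
  proof (intro conjI ballI \<psi>_cont)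
    show "continuous_map XW P \<phi>"
      unfolding P_def \<phi>_def using \<phi>_fst \<phi>_snd by (simp add: continuous_map_pairwise o_def)
    show "\<psi> (\<phi> F) = F" if "F \<in> topspace XW" for F
    proof -
      have "transition F (s (gram_map a F)) * s (gram_map a F) = F"
        using that s by (intro transition_of_equal_gram(2)) (simp_all add: XW)
      then show ?thesis by (simp add: \<psi>_def \<phi>_def)
    qed
    show "\<phi> (\<psi> p) = p" if "p \<in> topspace P" for p
    proof -
      obtain R V where p: "p = (R, V)" by (cases p)
      with that have RV: "R \<in> W" "V \<in> ellipsoid_group a" by (auto simp: P)
      then have "V \<in> carrier_mat n n" by (auto simp: ellipsoid_group_iff unitary_group_def)
      then show ?thesis
        using RV acts s by (simp add: p \<phi>_def \<psi>_def transition_mult)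
    qed
  qed
  then have "homeomorphic_map XW P \<phi>" by (rule homeomorphic_maps_imp_map)
  then show "\<exists>W. openin ?Y W \<and> R0 \<in> W \<and>
      (\<exists>\<phi>. homeomorphic_map (subtopology ?X {x \<in> topspace ?X. gram_map a x \<in> W})
         (prod_topology (subtopology ?Y W) ?T) \<phi> \<and>
         (\<forall>x\<in>topspace ?X. gram_map a x \<in> W \<longrightarrow> fst (\<phi> x) = gram_map a x))"
    using W unfolding XW_def P_def by (intro exI[of _ W] conjI exI[of _ \<phi>]) (auto simp: \<phi>_def)
qed

end

theorem theorem2p2:
  fixes n k :: nat and a :: "real vec"
  assumes "1 \<le> n" and "n \<le> k"
    and "a \<in> carrier_vec n"
    and "\<forall>i j. i \<le> j \<longrightarrow> j < n \<longrightarrow> a $ j \<le> a $ i"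
    and "\<forall>i<n. 0 < a $ i"
  shows "locally_trivial_bundle
           (frame_space k a :: real mat topology)
           (gram_space k a :: real mat topology)
           (gram_map a)
           (ellipsoid_group_space a :: real mat topology)
       \<and> locally_trivial_bundle
           (frame_space k a :: complex mat topology)
           (gram_space k a :: complex mat topology)
           (gram_map a)
           (ellipsoid_group_space a :: complex mat topology)"
proof -
  interpret semiaxes n k a using assms by unfold_locales auto
  show ?thesis by (intro conjI gram_map_bundle)
qed

end
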